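(* Let $f:2^{\mathcal U}\to\mathbb{R}_{\ge0}$ be submodular on a ground set $\mathcal U$ with $|\mathcal U|=n$, given by a value oracle, let $k$ be a positive integer, let $\epsilon>0$, and let $O\in\arg\max_{S\subseteq\mathcal U,|S|\le k}f(S)$. Let $\ell$ be a positive integer with $\ell=O(\epsilon^{-1})$ and $\ell\ge\frac{2}{e\epsilon}$, and suppose $k\ge\frac{2(e\ell-2)}{e\epsilon-\frac{2}{\ell}}$. Run the following randomized algorithm on input $(f,k,\ell,\epsilon)$. Add a set $D$ of $2k$ dummy elements to the ground set, extending $f$ by $f(S)=f(S\setminus D)$; let $\mathcal U'=\mathcal U\cup D$, $m=\lfloor k/\ell\rfloor$ and $G\leftarrow\emptyset$. For $i=1,\dots,\ell$: set $A_l\leftarrow G$ for all $l\in[\ell]$; for $j=1,\dots,m$ and, within that, for $l=1,\dots,\ell$ in order: choose $a\in\arg\max_{x\in\mathcal U'\setminus\bigcup_{r\in[\ell]}A_r}\Delta(x\mid A_l)$ and set $A_l\leftarrow A_l\cup\{a\}$; after these loops set $G$ to be one of $A_1,\dots,A_\ell$ chosen uniformly at random. Return $G$. Then the algorithm makes $O(kn/\epsilon)$ oracle queries and returns a set $G$ with $\mathbb{E}[f(G)]\ge(1/e-\epsilon)f(O)$.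
   Context: A set function $f$ is submodular if $f(X)+f(Y)\ge f(X\cup Y)+f(X\cap Y)$ for all $X,Y$; $f$ is not assumed monotone. $\Delta(x\mid Y)=f(Y\cup\{x\})-f(Y)$. Query complexity counts evaluations of $f$. The expectation is over the random choices of the algorithm. *)

theory Defs
  imports "HOL-Probability.Probability" "HOL-Library.Monad_Syntax"
begin

definition submodular_on :: "'a set \<Rightarrow> ('a set \<Rightarrow> real) \<Rightarrow> bool" where
  "submodular_on U f \<longleftrightarrow>
     (\<forall>X Y. X \<subseteq> U \<longrightarrow> Y \<subseteq> U \<longrightarrow> f X + f Y \<ge> f (X \<union> Y) + f (X \<inter> Y))"

text \<open>
  Randomized programs with access to a value oracle for a set function. A program learns about the
  function only through the answers to its \<open>Query\<close> nodes; \<open>Uniform N\<close> draws an index uniformly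
  from \<open>{1..N}\<close>. Running a program against \<open>f\<close> gives the joint distribution of its result and of
  the number of evaluations of \<open>f\<close> it has made.
\<close>

datatype ('a, 'r) oracle_prog =
    Done 'r
  | Query "'a set" "real \<Rightarrow> ('a, 'r) oracle_prog"
  | Uniform nat "nat \<Rightarrow> ('a, 'r) oracle_prog"

primrec bind_prog ::
  "('a, 'r) oracle_prog \<Rightarrow> ('r \<Rightarrow> ('a, 's) oracle_prog) \<Rightarrow> ('a, 's) oracle_prog" where
  "bind_prog (Done r) g = g r"
| "bind_prog (Query S c) g = Query S (\<lambda>v. bind_prog (c v) g)"
| "bind_prog (Uniform N c) g = Uniform N (\<lambda>l. bind_prog (c l) g)"

adhoc_overloading Monad_Syntax.bind \<rightleftharpoons> bind_prog

primrec run :: "('a set \<Rightarrow> real) \<Rightarrow> ('a, 'r) oracle_prog \<Rightarrow> ('r \<times> nat) pmf" where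
  "run f (Done r) = return_pmf (r, 0)"
| "run f (Query S c) = map_pmf (\<lambda>(r, q). (r, Suc q)) (run f (c (f S)))"
| "run f (Uniform N c) = bind_pmf (pmf_of_set {1..N}) (\<lambda>l. run f (c l))"

primrec for_each ::
  "'b list \<Rightarrow> ('b \<Rightarrow> 's \<Rightarrow> ('a, 's) oracle_prog) \<Rightarrow> 's \<Rightarrow> ('a, 's) oracle_prog" where
  "for_each [] body s = Done s"
| "for_each (x # xs) body s = do { s' \<leftarrow> body x s; for_each xs body s' }"

text \<open>
  The ground set extended by \<open>2 * k\<close> dummies: \<open>Inl\<close> marks original elements and \<open>Inr\<close> marks
  dummies, so that \<open>genuine S\<close> is \<open>S\<close> without its dummies, and the extension of \<open>f\<close> to the
  enlarged ground set is \<open>\<lambda>S. f (genuine S)\<close>. The original ground set is given as a list, which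
  fixes the order in which a greedy step evaluates the marginal gains.
\<close>

definition ground :: "'a list \<Rightarrow> nat \<Rightarrow> ('a + nat) list" where
  "ground us k = map Inl us @ map Inr [0..<2 * k]"

definition genuine :: "('a + nat) set \<Rightarrow> 'a set" where
  "genuine S = Inl -` S"

definition marginal :: "('a set \<Rightarrow> real) \<Rightarrow> 'a + nat \<Rightarrow> ('a + nat) set \<Rightarrow> real" where
  "marginal f x Y = f (genuine (insert x Y)) - f (genuine Y)"

text \<open>
  Computing the marginal gain of an original element takes two evaluations of \<open>f\<close>; that of a dummy
  is 0 whatever \<open>f\<close> is, and takes none.
\<close>

definition query_marginal :: "'a + nat \<Rightarrow> ('a + nat) set \<Rightarrow> ('a, real) oracle_prog" where
  "query_marginal x Y = (case x of
       Inl _ \<Rightarrow> Query (genuine (insert x Y)) (\<lambda>v. Query (genuine Y) (\<lambda>w. Done (v - w)))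
     | Inr _ \<Rightarrow> Done 0)"

lemma run_query_marginal:
  "run f (query_marginal x Y) = return_pmf (marginal f x Y, if isl x then 2 else 0)"
  by (cases x) (auto simp: query_marginal_def marginal_def genuine_def vimage_def
      intro!: arg_cong[where f = f])

primrec query_marginals ::
  "('a + nat) list \<Rightarrow> ('a + nat) set \<Rightarrow> ('a, (('a + nat) \<times> real) list) oracle_prog" where
  "query_marginals [] Y = Done []"
| "query_marginals (x # xs) Y =
     do { v \<leftarrow> query_marginal x Y; ps \<leftarrow> query_marginals xs Y; Done ((x, v) # ps) }"

lemma run_bind_prog:
  "run f (bind_prog p g) =
     bind_pmf (run f p) (\<lambda>(r, q). map_pmf (\<lambda>(s, q'). (s, q + q')) (run f (g r)))"
  by (induction p)
    (simp_all add: map_bind_pmf bind_map_pmf bind_assoc_pmf bind_return_pmf pmf.map_comp comp_def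
      case_prod_unfold)

lemma run_query_marginals:
  "run f (query_marginals xs Y) =
     return_pmf (map (\<lambda>x. (x, marginal f x Y)) xs, 2 * length (filter isl xs))"
  by (induction xs)
    (simp_all add: run_bind_prog run_query_marginal bind_return_pmf)

definition maximizers :: "('b \<times> real) list \<Rightarrow> 'b set" where
  "maximizers ps = {x. \<exists>v. (x, v) \<in> set ps \<and> (\<forall>(y, w) \<in> set ps. w \<le> v)}"

lemma maximizers_marginal:
  "maximizers (map (\<lambda>x. (x, marginal f x Y)) xs) =
     {x. is_arg_max (\<lambda>x. marginal f x Y) (\<lambda>x. x \<in> set xs) x}"
  by (auto simp: maximizers_def is_arg_max_linorder)

text \<open>
  The arg max in a greedy step need not be unique. Ties are resolved by a rule \<open>tb h j l\<close>, where
  \<open>h\<close> is the list of indices drawn in the completed outer iterations and \<open>j\<close>, \<open>l\<close> are the inner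
  loop counters. For a given \<open>f\<close> these data determine the whole computation so far, so every way
  of choosing among maximizers arises from such a rule.
\<close>

type_synonym 'a tie_break =
  "nat list \<Rightarrow> nat \<Rightarrow> nat \<Rightarrow> ('a + nat) set \<Rightarrow> 'a + nat"

definition valid_tie_break :: "'a tie_break \<Rightarrow> bool" where
  "valid_tie_break tb \<longleftrightarrow> (\<forall>h j l M. M \<noteq> {} \<longrightarrow> tb h j l M \<in> M)"

definition greedy_step ::
  "'a list \<Rightarrow> nat \<Rightarrow> nat \<Rightarrow> (('a + nat) set \<Rightarrow> 'a + nat) \<Rightarrow> nat \<Rightarrow>
   (nat \<Rightarrow> ('a + nat) set) \<Rightarrow> ('a, nat \<Rightarrow> ('a + nat) set) oracle_prog" where
  "greedy_step us k L pick l A = do {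
     ps \<leftarrow> query_marginals (filter (\<lambda>x. x \<notin> (\<Union>r\<in>{1..L}. A r)) (ground us k)) (A l);
     let a = pick (maximizers ps);
     Done (A(l := insert a (A l)))
   }"

definition outer_iteration ::
  "'a list \<Rightarrow> nat \<Rightarrow> nat \<Rightarrow> 'a tie_break \<Rightarrow> nat list \<times> ('a + nat) set \<Rightarrow>
   ('a, nat list \<times> ('a + nat) set) oracle_prog" where
  "outer_iteration us k L tb = (\<lambda>(h, G). do {
     A \<leftarrow> for_each [1..<Suc (k div L)]
            (\<lambda>j. for_each [1..<Suc L] (\<lambda>l. greedy_step us k L (tb h j l) l)) (\<lambda>_. G);
     Uniform L (\<lambda>l. Done (h @ [l], A l))
   })"

definition interlaced_greedy ::
  "'a list \<Rightarrow> nat \<Rightarrow> nat \<Rightarrow> 'a tie_break \<Rightarrow> ('a, ('a + nat) set) oracle_prog" where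
  "interlaced_greedy us k L tb = do {
     (h, G) \<leftarrow> for_each [1..<Suc L] (\<lambda>_. outer_iteration us k L tb) ([], {});
     Done G
   }"

end

theory Submission
  imports Defs
begin

text \<open>
  Let \<open>F\<close> be the extension of \<open>f\<close> to the ground set with dummies, \<open>m = k div L\<close>, and let \<open>A\<^sub>1, \<dots>, A\<^sub>L\<close>
  be the sets built from \<open>G\<close> in one outer iteration. Outside \<open>G\<close> they are disjoint, so submodularity
  and nonnegativity give \<open>\<Sum>F(Opt \<union> A\<^sub>l) \<ge> (L - 1) F(Opt \<union> G)\<close>: joining a random \<open>A\<^sub>l\<close> to \<open>Opt\<close> costs at
  most a factor \<open>1 - 1/L\<close>. On the other hand each marginal gain of an element of \<open>Opt\<close> over \<open>A\<^sub>l\<close> can be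
  charged to a greedy gain so that every greedy step pays for about \<open>k / m\<close> elements, whence
  \<open>m \<Sum>(F(Opt \<union> A\<^sub>l) - F(A\<^sub>l)) \<le> L (m + 2) \<Sum>(F(A\<^sub>l) - F(G))\<close>. With \<open>d = 1 - 1/L\<close> and
  \<open>\<beta> = m / (L (m + 2))\<close>, backward induction over the outer iterations shows that \<open>t\<close> further
  iterations from \<open>G\<close> yield at least \<open>d\<^sup>t F(G) + t \<beta> d\<^bsup>t+1\<^esup> F(Opt \<union> G)\<close> in expectation. For \<open>t = L\<close> and
  \<open>G = {}\<close> this is at least \<open>(1/e) (1 - 2/L) (1 - 2/(m + 2)) F(Opt)\<close>.
\<close>

section \<open>Submodular functions\<close>

lemma submodular_onD:
  assumes "submodular_on U f" "X \<subseteq> U" "Y \<subseteq> U"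
  shows "f (X \<union> Y) + f (X \<inter> Y) \<le> f X + f Y"
  using assms unfolding submodular_on_def by auto

lemma submodular_on_gain_antimono:
  assumes "submodular_on U f" "A \<subseteq> B" "B \<subseteq> U" "x \<in> U" "x \<notin> B"
  shows "f (insert x B) - f B \<le> f (insert x A) - f A"
proof -
  have "insert x A \<union> B = insert x B" "insert x A \<inter> B = A"
    using assms by auto
  moreover have "f (insert x A \<union> B) + f (insert x A \<inter> B) \<le> f (insert x A) + f B"
    using assms by (intro submodular_onD) auto
  ultimately show ?thesis by simp
qed

lemma submodular_on_gain_Un_le:
  assumes "submodular_on U f" "A \<subseteq> U" "X \<subseteq> U" "Y \<subseteq> U" "X \<inter> Y \<subseteq> A"
  shows "f (A \<union> (X \<union> Y)) - f A \<le> (f (A \<union> X) - f A) + (f (A \<union> Y) - f A)"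
proof -
  have "(A \<union> X) \<union> (A \<union> Y) = A \<union> (X \<union> Y)" "(A \<union> X) \<inter> (A \<union> Y) = A"
    using assms by auto
  moreover have "f ((A \<union> X) \<union> (A \<union> Y)) + f ((A \<union> X) \<inter> (A \<union> Y)) \<le> f (A \<union> X) + f (A \<union> Y)"
    using assms by (intro submodular_onD) auto
  ultimately show ?thesis by simp
qed

lemma submodular_on_gain_UN_le:
  assumes "submodular_on U f" "finite I" "A \<subseteq> U" "\<And>i. i \<in> I \<Longrightarrow> P i \<subseteq> U"
    and "\<And>i j. i \<in> I \<Longrightarrow> j \<in> I \<Longrightarrow> i \<noteq> j \<Longrightarrow> P i \<inter> P j \<subseteq> A"
  shows "f (A \<union> (\<Union>i\<in>I. P i)) - f A \<le> (\<Sum>i\<in>I. f (A \<union> P i) - f A)"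
  using assms(2,4,5)
proof (induction I rule: finite_induct)
  case (insert i I)
  have "f (A \<union> (P i \<union> (\<Union>i\<in>I. P i))) - f A \<le> (f (A \<union> P i) - f A) + (f (A \<union> (\<Union>i\<in>I. P i)) - f A)"
  proof (rule submodular_on_gain_Un_le[OF assms(1,3)])
    show "P i \<inter> (\<Union>i\<in>I. P i) \<subseteq> A"
      using insert.prems(2)[of i] insert.hyps(2) by fastforce
  qed (use insert.prems(1) in auto)
  moreover have "f (A \<union> (\<Union>i\<in>I. P i)) - f A \<le> (\<Sum>i\<in>I. f (A \<union> P i) - f A)"
    using insert.prems by (intro insert.IH) auto
  ultimately show ?case
    using insert.hyps by simp
qed simp

text \<open>The gains of the \<open>B l\<close> over \<open>E\<close> add up to at least the gain of
  their union, which is at least \<open>- f E\<close> by nonnegativity. This takes the place of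
  monotonicity: all \<open>L\<close> extensions of \<open>E\<close> together lose at most one copy
  of \<open>f E\<close>.\<close>

lemma submodular_on_sum_ge:
  fixes f :: "'a set \<Rightarrow> real"
  assumes "submodular_on U f" "\<forall>S\<subseteq>U. 0 \<le> f S" "E \<subseteq> U"
    and "\<And>l. l < L \<Longrightarrow> E \<subseteq> B l \<and> B l \<subseteq> U"
    and "\<And>l r. l < L \<Longrightarrow> r < L \<Longrightarrow> l \<noteq> r \<Longrightarrow> B l \<inter> B r \<subseteq> E"
  shows "(real L - 1) * f E \<le> (\<Sum>l<L. f (B l))"
proof -
  have "f (E \<union> (\<Union>l<L. B l)) - f E \<le> (\<Sum>l<L. f (E \<union> B l) - f E)"
    using assms by (intro submodular_on_gain_UN_le[of U]) auto
  also have "\<dots> = (\<Sum>l<L. f (B l) - f E)"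
    using assms(4) by (intro sum.cong refl) (simp add: Un_absorb1)
  also have "\<dots> = (\<Sum>l<L. f (B l)) - real L * f E"
    by (simp add: sum_subtractf)
  finally have "f (E \<union> (\<Union>l<L. B l)) - f E \<le> (\<Sum>l<L. f (B l)) - real L * f E" .
  moreover have "0 \<le> f (E \<union> (\<Union>l<L. B l))"
    using assms(3,4) by (intro assms(2)[rule_format]) auto
  ultimately show ?thesis by (simp add: algebra_simps)
qed

text \<open>The largest index is at least \<open>p\<close> plus the number of the others, so closing
  the gaps only moves indices down, where \<open>h\<close> is at least as large.\<close>

lemma sum_antimono_le_initial:
  fixes h :: "nat \<Rightarrow> real"
  assumes anti: "\<And>i j. i \<le> j \<Longrightarrow> h j \<le> h i" and "finite J" "J \<subseteq> {p..}"
  shows "sum h J \<le> sum h {p..<p + card J}"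
  using assms(2,3)
proof (induction J rule: finite_linorder_max_induct)
  case (insert b J)
  have "J \<subseteq> {p..<b}"
    using insert by auto
  then have "card J \<le> b - p"
    using card_mono[of "{p..<b}" J] by simp
  then have "h b \<le> h (p + card J)"
    using insert.prems by (intro anti) auto
  moreover have "b \<notin> J"
    using insert.hyps by auto
  ultimately show ?case
    using insert by simp
qed simp

section \<open>One outer iteration\<close>

text \<open>\<open>a r j\<close> is the element that sequence \<open>r\<close> takes in round
  \<open>j\<close>, both counted from 0. Within a round the sequences move in increasing order of
  \<open>r\<close>, so an element outside \<open>G\<close> is a candidate unless it was taken at a
  lexicographically smaller pair of round and sequence. \<open>gain_nonneg\<close> reflects the
  supply of dummies.\<close>

locale interlaced_sequences =
  fixes X :: "'b set" and F :: "'b set \<Rightarrow> real" and G :: "'b set"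
    and a :: "nat \<Rightarrow> nat \<Rightarrow> 'b" and L m :: nat
  assumes finite_X: "finite X"
    and submod: "submodular_on X F"
    and G_subset: "G \<subseteq> X"
    and a_in: "\<And>r j. r < L \<Longrightarrow> j < m \<Longrightarrow> a r j \<in> X - G"
    and a_inj: "\<And>r j r' j'. r < L \<Longrightarrow> j < m \<Longrightarrow> r' < L \<Longrightarrow> j' < m \<Longrightarrow>
      a r j = a r' j' \<Longrightarrow> r = r' \<and> j = j'"
    and gain_nonneg: "\<And>r j. r < L \<Longrightarrow> j < m \<Longrightarrow> F (G \<union> a r ` {..<j}) \<le> F (G \<union> a r ` {..<Suc j})"
    and greedy: "\<And>r j x. r < L \<Longrightarrow> j < m \<Longrightarrow> x \<in> X - G \<Longrightarrow>
      (\<And>r' j'. r' < L \<Longrightarrow> j' < j \<or> j' = j \<and> r' < r \<Longrightarrow> x \<noteq> a r' j') \<Longrightarrow>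
      F (insert x (G \<union> a r ` {..<j})) \<le> F (G \<union> a r ` {..<Suc j})"
begin

definition A :: "nat \<Rightarrow> nat \<Rightarrow> 'b set" where
  "A r j = G \<union> a r ` {..<j}"

text \<open>The value 0 from \<open>m\<close> on keeps the gains nonnegative and nonincreasing while
  letting index ranges such as \<open>{..<card (hits r) + 1}\<close> run past
  \<open>m\<close>.\<close>

definition gain :: "nat \<Rightarrow> nat \<Rightarrow> real" where
  "gain r j = (if j < m then F (A r (Suc j)) - F (A r j) else 0)"

lemma A_subset: "r < L \<Longrightarrow> j \<le> m \<Longrightarrow> A r j \<subseteq> X"
  using G_subset a_in[of r] by (auto simp: A_def)

lemma A_mono: "i \<le> j \<Longrightarrow> A r i \<subseteq> A r j"
  by (auto simp: A_def)

lemma a_notin_A_other: "r < L \<Longrightarrow> r' < L \<Longrightarrow> r \<noteq> r' \<Longrightarrow> j' < m \<Longrightarrow> a r' j' \<notin> A r m"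
  using a_in[of r' j'] by (auto simp: A_def dest: a_inj)

lemma a_notin_A_later: "r < L \<Longrightarrow> j < m \<Longrightarrow> a r j \<notin> A r j"
  using a_in[of r j] by (auto simp: A_def dest!: a_inj[of r j r, rotated 4])

lemma A_Int_A: "r < L \<Longrightarrow> r' < L \<Longrightarrow> r \<noteq> r' \<Longrightarrow> p \<le> m \<Longrightarrow> A r m \<inter> A r' p = G"
  by (auto simp: A_def dest: a_inj[rotated 4])

lemma gain_ge_0: "r < L \<Longrightarrow> 0 \<le> gain r j"
  using gain_nonneg by (auto simp: gain_def A_def)

lemma sum_gain: "p \<le> m \<Longrightarrow> (\<Sum>j<p. gain r j) = F (A r p) - F G"
  by (induction p) (auto simp: gain_def A_def)

text \<open>The element taken in round \<open>j\<close> was already a candidate in round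
  \<open>i\<close>, where the greedy choice gained at least as much; by submodularity its gain has
  only shrunk since.\<close>

lemma gain_antimono:
  assumes "r < L" "i \<le> j"
  shows "gain r j \<le> gain r i"
proof (cases "j < m \<and> i < j")
  case True
  have "F (insert (a r j) (A r j)) - F (A r j) \<le> F (insert (a r j) (A r i)) - F (A r i)"
    using True assms a_in[of r j] A_subset[of r j] A_mono[of i j r] a_notin_A_later[of r j]
    by (intro submodular_on_gain_antimono[OF submod]) auto
  moreover have "insert (a r j) (A r j) = A r (Suc j)"
    by (auto simp: A_def lessThan_Suc)
  moreover have "F (insert (a r j) (A r i)) \<le> F (A r (Suc i))"
    unfolding A_def
  proof (rule greedy)
    fix r' j' assume "r' < L" "j' < i \<or> j' = i \<and> r' < r"
    then show "a r j \<noteq> a r' j'"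
      using True assms a_inj[of r j r' j'] by auto
  qed (use True assms a_in[of r j] in auto)
  ultimately show ?thesis
    using True by (simp add: gain_def)
next
  case False
  then show ?thesis
    using assms gain_ge_0[of r i] by (cases "i = j") (auto simp: gain_def)
qed

lemma late_gain_le:
  assumes "r < L" "r' < L" "r \<noteq> r'" "j' < m" "j < j' \<or> j = j' \<and> r < r'"
  shows "F (insert (a r' j') (A r m)) - F (A r m) \<le> gain r j"
proof -
  have "F (insert (a r' j') (A r m)) - F (A r m) \<le> F (insert (a r' j') (A r j)) - F (A r j)"
    using assms a_in[of r' j'] A_subset[of r m] A_mono[of j m r] a_notin_A_other[of r r' j']
    by (intro submodular_on_gain_antimono[OF submod]) auto
  moreover have "F (insert (a r' j') (A r j)) \<le> F (A r (Suc j))"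
    unfolding A_def
  proof (rule greedy)
    fix s i assume "s < L" "i < j \<or> i = j \<and> s < r"
    then show "a r' j' \<noteq> a s i"
      using assms a_inj[of r' j' s i] by auto
  qed (use assms a_in[of r' j'] in auto)
  ultimately show ?thesis
    using assms by (auto simp: gain_def)
qed

lemma outside_gain_le:
  assumes "r < L" "j < m" "x \<in> X - G" "\<And>r' j'. r' < L \<Longrightarrow> j' < m \<Longrightarrow> x \<noteq> a r' j'"
  shows "F (insert x (A r m)) - F (A r m) \<le> gain r j"
proof -
  have "F (insert x (A r m)) - F (A r m) \<le> F (insert x (A r j)) - F (A r j)"
    using assms A_subset[of r m] A_mono[of j m r]
    by (intro submodular_on_gain_antimono[OF submod]) (auto simp: A_def)
  moreover have "F (insert x (A r j)) \<le> F (A r (Suc j))"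
    unfolding A_def
  proof (rule greedy)
    fix s i assume "s < L" "i < j \<or> i = j \<and> s < r"
    then show "x \<noteq> a s i"
      using assms(2) assms(4)[of s i] by auto
  qed (use assms in auto)
  ultimately show ?thesis
    using assms by (simp add: gain_def)
qed

section \<open>Charging the elements of a comparison set to greedy gains\<close>

context
  fixes Opt :: "'b set"
  assumes Opt_subset: "Opt \<subseteq> X"
begin

definition hits :: "nat \<Rightarrow> nat set" where
  "hits r = {j. j < m \<and> a r j \<in> Opt}"

definition view :: "nat \<Rightarrow> nat \<Rightarrow> real" where
  "view l r = F (A l m \<union> a r ` hits r) - F (A l m)"

lemma finite_hits [simp]: "finite (hits r)"
  by (simp add: hits_def)

lemma card_hits_le: "card (hits r) \<le> m"
  using card_mono[of "{..<m}" "hits r"] by (auto simp: hits_def)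

text \<open>The first \<open>p\<close> elements of sequence \<open>r\<close> are paid for together:
  \<open>A l m\<close> and \<open>A r p\<close> meet only in \<open>G\<close>, so joining the second
  to the first gains at most \<open>F (A r p) - F G\<close>, which \<open>r\<close> itself gained in
  those rounds. The remaining hits are paid for one by one.\<close>

lemma view_le:
  assumes "l < L" "r < L" "l \<noteq> r" and p: "{..<p} \<subseteq> hits r"
  shows "view l r \<le> (\<Sum>j<p. gain r j) +
    (\<Sum>j\<in>hits r \<inter> {p..}. F (insert (a r j) (A l m)) - F (A l m))"
proof -
  let ?T = "hits r \<inter> {p..}"
  have pm: "p \<le> m"
    using card_mono[OF finite_hits p] card_hits_le[of r] by simp
  have split: "a r ` hits r = a r ` {..<p} \<union> (\<Union>j\<in>?T. {a r j})"
    using p by force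
  have "F (A l m \<union> (a r ` {..<p} \<union> (\<Union>j\<in>?T. {a r j}))) - F (A l m)
      \<le> (F (A l m \<union> a r ` {..<p}) - F (A l m)) + (F (A l m \<union> (\<Union>j\<in>?T. {a r j})) - F (A l m))"
  proof (rule submodular_on_gain_Un_le[OF submod])
    show "a r ` {..<p} \<inter> (\<Union>j\<in>?T. {a r j}) \<subseteq> A l m"
      using pm assms(2) by (auto simp: hits_def dest!: a_inj[of r _ r, rotated 4])
  qed (use assms pm A_subset a_in in \<open>fastforce simp: hits_def\<close>)+
  moreover have "F (A l m \<union> (\<Union>j\<in>?T. {a r j})) - F (A l m)
      \<le> (\<Sum>j\<in>?T. F (A l m \<union> {a r j}) - F (A l m))"
    using assms A_subset a_in a_inj[of r _ r]
    by (intro submodular_on_gain_UN_le[OF submod]) (auto simp: hits_def)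
  moreover have "F (A l m \<union> a r ` {..<p}) - F (A l m) \<le> F (A r p) - F G"
  proof -
    have "A l m \<union> A r p = A l m \<union> a r ` {..<p}"
      by (auto simp: A_def)
    moreover have "F (A l m \<union> A r p) + F (A l m \<inter> A r p) \<le> F (A l m) + F (A r p)"
      using assms pm A_subset by (intro submodular_onD[OF submod]) auto
    ultimately show ?thesis
      using A_Int_A[OF assms(1-3) pm] by simp
  qed
  ultimately show ?thesis
    using sum_gain[OF pm, of r] by (simp add: view_def split)
qed

text \<open>Since \<open>l < r\<close>, the element that \<open>r\<close> takes in round
  \<open>j\<close> was still free when \<open>l\<close> moved in that round, so
  \<open>gain l j\<close> bounds its gain over \<open>A l m\<close>. Gains are nonincreasing, so
  scattered rounds may be replaced by consecutive ones from \<open>p\<close> on.\<close>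

lemma tail_le:
  assumes "l < r" "r < L" and T: "T \<subseteq> hits r" "T \<subseteq> {p..}"
  shows "(\<Sum>j\<in>T. F (insert (a r j) (A l m)) - F (A l m)) \<le> (\<Sum>j=p..<p + card T. gain l j)"
proof -
  have "finite T"
    using T(1) by (rule finite_subset) simp
  have "(\<Sum>j\<in>T. F (insert (a r j) (A l m)) - F (A l m)) \<le> (\<Sum>j\<in>T. gain l j)"
    using assms by (intro sum_mono late_gain_le) (auto simp: hits_def)
  also have "\<dots> \<le> (\<Sum>j=p..<p + card T. gain l j)"
    using assms \<open>finite T\<close> gain_antimono[of l] by (intro sum_antimono_le_initial) auto
  finally show ?thesis .
qed

text \<open>Whichever of \<open>l\<close> and \<open>r\<close> moves first, the element taken in
  round \<open>j\<close> was free one round earlier, so it is charged to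
  \<open>gain l (j - 1)\<close>. Starting \<open>T\<close> at \<open>Suc p\<close> makes room for
  this shift.\<close>

lemma shifted_tail_le:
  assumes "l < L" "r < L" "l \<noteq> r" and T: "T \<subseteq> hits r" "T \<subseteq> {Suc p..}"
  shows "(\<Sum>j\<in>T. F (insert (a r j) (A l m)) - F (A l m)) \<le> (\<Sum>j=p..<p + card T. gain l j)"
proof -
  have fin: "finite T"
    using T(1) by (rule finite_subset) simp
  have inj: "inj_on (\<lambda>j. j - 1) T"
    using T(2) by (intro inj_onI) (metis One_nat_def Suc_pred atLeast_iff subsetD zero_less_Suc less_le_trans)
  have "(\<Sum>j\<in>T. F (insert (a r j) (A l m)) - F (A l m)) \<le> (\<Sum>j\<in>T. gain l (j - 1))"
    using assms by (intro sum_mono late_gain_le) (auto simp: hits_def)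
  also have "\<dots> = sum (gain l) ((\<lambda>j. j - 1) ` T)"
    using inj by (simp add: sum.reindex)
  also have "\<dots> \<le> (\<Sum>j=p..<p + card ((\<lambda>j. j - 1) ` T). gain l j)"
    using assms fin gain_antimono[of l] by (intro sum_antimono_le_initial) fastforce+
  finally show ?thesis
    using inj by (simp add: card_image)
qed

lemma initial_hits:
  obtains p where "{..<p} \<subseteq> hits r" "p \<notin> hits r" "p \<le> card (hits r)"
proof -
  have "\<exists>p. p \<notin> hits r"
    by (rule exI[of _ m]) (simp add: hits_def)
  then have 1: "(LEAST p. p \<notin> hits r) \<notin> hits r"
    by (rule LeastI_ex)
  have 2: "{..<(LEAST p. p \<notin> hits r)} \<subseteq> hits r"
    using not_less_Least by blast
  show ?thesis
    using that[OF 2 1] card_mono[OF finite_hits 2] by simp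
qed

lemma card_hits_tail:
  assumes "{..<p} \<subseteq> hits r"
  shows "card (hits r \<inter> {p..}) = card (hits r) - p"
proof -
  have "hits r \<inter> {p..} = hits r - {..<p}"
    by auto
  then show ?thesis
    using assms by (simp add: card_Diff_subset)
qed

lemma sum_gain_append:
  assumes "p \<le> q"
  shows "(\<Sum>j<p. gain r j) + (\<Sum>j=p..<q. gain r j) = (\<Sum>j<q. gain r j)"
  using assms sum.atLeastLessThan_concat[of 0 p q "gain r"] by (simp add: atLeast0LessThan)

text \<open>
  Element number \<open>j\<close> of sequence \<open>r\<close> is still available when sequence \<open>l\<close> makes its step \<open>j\<close> only
  if \<open>l < r\<close>, and otherwise only up to step \<open>j - 1\<close>. The missing step is made up for by letting
  the two sequences pay for each other's longest initial segment inside \<open>Opt\<close>, cut to a common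
  length (or to lengths that differ by one), after which a gap provides the shift.
\<close>

lemma view_pair_le:
  assumes "l < r" "r < L"
  shows "view l r + view r l \<le>
    (\<Sum>j<card (hits r) + 1. gain l j) + (\<Sum>j<card (hits l) + 1. gain r j)"
proof -
  obtain p where p: "{..<p} \<subseteq> hits l" "p \<notin> hits l" "p \<le> card (hits l)"
    by (rule initial_hits)
  obtain q where q: "{..<q} \<subseteq> hits r" "q \<notin> hits r" "q \<le> card (hits r)"
    by (rule initial_hits)
  have l: "l < L" "l \<noteq> r" "r \<noteq> l"
    using assms by auto
  have mono: "(\<Sum>j<i. gain s j) \<le> (\<Sum>j<i'. gain s j)" if "i \<le> i'" "s < L" for i i' s
    using that gain_ge_0 by (intro sum_mono2) auto
  show ?thesis
  proof (cases "p \<le> q")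
    case True
    have p': "{..<p} \<subseteq> hits r"
      using q(1) True by auto
    \<comment> \<open>Both segments are cut to length \<open>p\<close>. As \<open>p\<close> is no
      hit of \<open>l\<close>, the later hits of \<open>l\<close> start at \<open>Suc p\<close>,
      which is the gap needed for the shift; the tail of \<open>r\<close> needs none.\<close>
    have "hits l \<inter> {p..} \<subseteq> {Suc p..}"
      using p(2) by (auto simp: Suc_le_eq) (metis le_neq_implies_less)
    then have "view r l \<le> (\<Sum>j<p. gain l j) + (\<Sum>j=p..<p + (card (hits l) - p). gain r j)"
      using view_le[OF assms(2) l(1) l(3) p(1)] shifted_tail_le[OF assms(2) l(1) l(3), of "hits l \<inter> {p..}" p]
      by (simp add: card_hits_tail[OF p(1)])
    moreover have "view l r \<le> (\<Sum>j<p. gain r j) + (\<Sum>j=p..<p + (card (hits r) - p). gain l j)"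
      using view_le[OF l(1) assms(2) l(2) p'] tail_le[OF assms, of "hits r \<inter> {p..}" p]
      by (simp add: card_hits_tail[OF p'])
    moreover have "p + (card (hits l) - p) = card (hits l)" "p + (card (hits r) - p) = card (hits r)"
      using p(3) q(3) True by auto
    ultimately have "view l r + view r l \<le> (\<Sum>j<card (hits r). gain l j) + (\<Sum>j<card (hits l). gain r j)"
      using sum_gain_append[of p "card (hits r)" l] sum_gain_append[of p "card (hits l)" r] p(3) q(3) True
      by simp
    also have "\<dots> \<le> (\<Sum>j<card (hits r) + 1. gain l j) + (\<Sum>j<card (hits l) + 1. gain r j)"
      using assms by (intro add_mono mono) auto
    finally show ?thesis .
  next
    case False
    \<comment> \<open>Now \<open>q < p\<close>. Sequence \<open>l\<close> pays for its own first
      \<open>Suc q\<close> elements and \<open>r\<close> for its first \<open>q\<close>. The tail of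
      \<open>l\<close> shifts down to the gains of \<open>r\<close> from \<open>q\<close> on, and
      the tail of \<open>r\<close>, which starts after the gap at \<open>q\<close>, goes to the
      gains of \<open>l\<close> from \<open>Suc q\<close> on. This uneven cut produces the
      \<open>+ 1\<close> in the bound.\<close>
    then have p': "{..<Suc q} \<subseteq> hits l"
      using p(1) by auto
    have "view r l \<le> (\<Sum>j<Suc q. gain l j) + (\<Sum>j=q..<q + (card (hits l) - Suc q). gain r j)"
      using view_le[OF assms(2) l(1) l(3) p'] shifted_tail_le[OF assms(2) l(1) l(3), of "hits l \<inter> {Suc q..}" q]
      by (simp add: card_hits_tail[OF p'] del: sum.lessThan_Suc)
    moreover have "hits r \<inter> {q..} \<subseteq> {Suc q..}"
      using q(2) by (auto simp: Suc_le_eq) (metis le_neq_implies_less)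
    then have "view l r \<le> (\<Sum>j<q. gain r j) + (\<Sum>j=Suc q..<Suc q + (card (hits r) - q). gain l j)"
      using view_le[OF l(1) assms(2) l(2) q(1)] tail_le[OF assms, of "hits r \<inter> {q..}" "Suc q"]
      by (simp add: card_hits_tail[OF q(1)])
    moreover have "q + (card (hits l) - Suc q) = card (hits l) - 1"
        "Suc q + (card (hits r) - q) = card (hits r) + 1"
      using p(3) q(3) False by auto
    moreover have "q \<le> card (hits l) - 1" "Suc q \<le> card (hits r) + 1"
      using p(3) q(3) False by auto
    ultimately have "view l r + view r l \<le> (\<Sum>j<card (hits r) + 1. gain l j) + (\<Sum>j<card (hits l) - 1. gain r j)"
      using sum_gain_append[of "Suc q" "card (hits r) + 1" l] sum_gain_append[of q "card (hits l) - 1" r]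
      by (simp del: sum.lessThan_Suc sum.op_ivl_Suc)
    also have "\<dots> \<le> (\<Sum>j<card (hits r) + 1. gain l j) + (\<Sum>j<card (hits l) + 1. gain r j)"
      using assms by (intro add_mono mono) auto
    finally show ?thesis .
  qed
qed

definition missed :: "'b set" where
  "missed = Opt - G - (\<Union>r<L. a r ` hits r)"

text \<open>What \<open>Opt\<close> adds to \<open>A l m\<close> was either taken by another
  sequence or missed by all. A missed element was free in every round, so even the last gain
  \<open>gain l (m - 1)\<close> bounds its gain; submodularity lets these bounds be added.\<close>

lemma Opt_gain_le:
  assumes "l < L" "m > 0"
  shows "F (Opt \<union> A l m) - F (A l m) \<le>
    (\<Sum>r\<in>{..<L} - {l}. view l r) + real (card missed) * gain l (m - 1)"
proof -
  let ?I = "{..<L} - {l}"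
  have fin: "finite missed"
    using Opt_subset finite_X by (auto simp: missed_def intro: finite_subset)
  have split: "Opt \<union> A l m = A l m \<union> ((\<Union>r\<in>?I. a r ` hits r) \<union> (\<Union>x\<in>missed. {x}))"
    using assms by (auto simp: missed_def hits_def A_def)
  have hits_X: "r < L \<Longrightarrow> a r ` hits r \<subseteq> X" for r
    using Opt_subset by (auto simp: hits_def)
  have missed_X: "missed \<subseteq> X - G"
    using Opt_subset by (auto simp: missed_def)
  have "F (A l m \<union> ((\<Union>r\<in>?I. a r ` hits r) \<union> (\<Union>x\<in>missed. {x}))) - F (A l m)
      \<le> (F (A l m \<union> (\<Union>r\<in>?I. a r ` hits r)) - F (A l m)) + (F (A l m \<union> (\<Union>x\<in>missed. {x})) - F (A l m))"
    using hits_X missed_X A_subset[of l m] assms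
    by (intro submodular_on_gain_Un_le[OF submod]) (auto simp: missed_def)
  moreover have "F (A l m \<union> (\<Union>r\<in>?I. a r ` hits r)) - F (A l m) \<le> (\<Sum>r\<in>?I. view l r)"
    unfolding view_def
  proof (rule submodular_on_gain_UN_le[OF submod])
    fix i j assume "i \<in> ?I" "j \<in> ?I" "i \<noteq> j"
    then show "a i ` hits i \<inter> a j ` hits j \<subseteq> A l m"
      using a_inj[of i _ j] by (auto simp: hits_def)
  qed (use hits_X A_subset[of l m] assms in auto)
  moreover have "F (A l m \<union> (\<Union>x\<in>missed. {x})) - F (A l m) \<le> (\<Sum>x\<in>missed. F (A l m \<union> {x}) - F (A l m))"
    using fin missed_X A_subset[of l m] assms by (intro submodular_on_gain_UN_le[OF submod]) auto
  moreover have "(\<Sum>x\<in>missed. F (A l m \<union> {x}) - F (A l m)) \<le> (\<Sum>x\<in>missed. gain l (m - 1))"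
  proof (rule sum_mono)
    fix x assume x: "x \<in> missed"
    then have "F (insert x (A l m)) - F (A l m) \<le> gain l (m - 1)"
      using assms missed_X by (intro outside_gain_le) (auto simp: missed_def hits_def)
    then show "F (A l m \<union> {x}) - F (A l m) \<le> gain l (m - 1)"
      by simp
  qed
  ultimately show ?thesis
    by (simp add: split)
qed

lemma card_missed_hits: "card missed + (\<Sum>r<L. card (hits r)) \<le> card Opt"
proof -
  have fin: "finite Opt"
    using Opt_subset finite_X by (rule finite_subset)
  have "card (\<Union>r<L. a r ` hits r) = (\<Sum>r<L. card (a r ` hits r))"
    using a_inj by (intro card_UN_disjoint) (fastforce simp: hits_def)+
  also have "\<dots> = (\<Sum>r<L. card (hits r))"
    using a_inj by (intro sum.cong refl card_image) (fastforce simp: hits_def inj_on_def)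
  finally have "card missed + (\<Sum>r<L. card (hits r)) = card (missed \<union> (\<Union>r<L. a r ` hits r))"
    using fin by (subst card_Un_disjoint) (auto simp: missed_def)
  also have "\<dots> \<le> card Opt"
    using fin by (intro card_mono) (auto simp: missed_def hits_def)
  finally show ?thesis .
qed

text \<open>Let \<open>c\<close> be the last gain and \<open>T\<close> the sum of all gains of
  \<open>l\<close>. A partial sum falls short of \<open>T\<close> by at least \<open>c\<close> per
  absent term, fewer than \<open>L * (m + 1)\<close> elements have to be paid for, and
  \<open>m * c\<close> is at most \<open>T\<close>.\<close>

lemma charged_gain_le:
  assumes "l < L" "m > 0" "card Opt < L * (m + 1)"
  shows "real m * ((\<Sum>r\<in>{..<L} - {l}. \<Sum>j<card (hits r) + 1. gain l j) + real (card missed) * gain l (m - 1))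
    \<le> real L * (real m + 2) * (\<Sum>j<m. gain l j)"
proof -
  let ?c = "gain l (m - 1)" and ?T = "\<Sum>j<m. gain l j" and ?I = "{..<L} - {l}"
  have c0: "0 \<le> ?c"
    using assms gain_ge_0 by simp
  have mc: "real m * ?c \<le> ?T"
    using sum_mono[of "{..<m}" "\<lambda>_. ?c" "gain l"] assms gain_antimono[of l] by auto
  have part: "(\<Sum>j<N + 1. gain l j) \<le> ?T - (real m - real N - 1) * ?c" if "N \<le> m" for N
  \<comment> \<open>For \<open>N = m\<close> the sum has the extra term \<open>gain l m\<close>,
    which is 0 by definition, while the bound is \<open>?T + ?c\<close>.\<close>
  proof (cases "N = m")
    case True
    then show ?thesis
      using c0 by (simp add: gain_def)
  next
    case False
    then have "(\<Sum>j<N + 1. gain l j) + (\<Sum>j=N+1..<m. gain l j) = ?T"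
      using that by (intro sum_gain_append) auto
    moreover have "(\<Sum>j=N+1..<m. ?c) \<le> (\<Sum>j=N+1..<m. gain l j)"
      using assms by (intro sum_mono gain_antimono) auto
    ultimately show ?thesis
      using that False by (simp add: of_nat_diff algebra_simps)
  qed
  have cardI: "real (card ?I) = real L - 1"
    using assms by (simp add: of_nat_diff)
  have "(\<Sum>r\<in>?I. \<Sum>j<card (hits r) + 1. gain l j)
      \<le> (\<Sum>r\<in>?I. ?T - (real m - real (card (hits r)) - 1) * ?c)"
    using card_hits_le by (intro sum_mono part)
  also have "\<dots> = (\<Sum>r\<in>?I. (?T - (real m - 1) * ?c) + real (card (hits r)) * ?c)"
    by (intro sum.cong refl) (simp add: algebra_simps)
  also have "\<dots> = (real L - 1) * (?T - (real m - 1) * ?c) + (\<Sum>r\<in>?I. real (card (hits r))) * ?c"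
    by (simp add: sum.distrib cardI sum_distrib_right)
  finally have *: "(\<Sum>r\<in>?I. \<Sum>j<card (hits r) + 1. gain l j) + real (card missed) * ?c
      \<le> (real L - 1) * (?T - (real m - 1) * ?c) + ((\<Sum>r\<in>?I. real (card (hits r))) + real (card missed)) * ?c"
    by (simp add: algebra_simps)
  have "(\<Sum>r\<in>?I. card (hits r)) \<le> (\<Sum>r<L. card (hits r))"
    by (intro sum_mono2) auto
  then have "(\<Sum>r\<in>?I. card (hits r)) + card missed \<le> L * (m + 1)"
    using card_missed_hits assms(3) by linarith
  then have "real ((\<Sum>r\<in>?I. card (hits r)) + card missed) \<le> real (L * (m + 1))"
    by (rule of_nat_mono)
  then have "((\<Sum>r\<in>?I. real (card (hits r))) + real (card missed)) * ?c \<le> (real L * (real m + 1)) * ?c"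
    using c0 by (intro mult_right_mono) (simp_all add: algebra_simps)
  with * have "(\<Sum>r\<in>?I. \<Sum>j<card (hits r) + 1. gain l j) + real (card missed) * ?c
      \<le> (real L - 1) * ?T + (real m + 2 * real L - 1) * ?c"
    by (simp add: algebra_simps)
  \<comment> \<open>Rounding \<open>m + 2 * L - 1\<close> up makes the final coefficient
    \<open>m * (L - 1) + (m + 2 * L)\<close> equal to \<open>L * (m + 2)\<close>.\<close>
  also have "\<dots> \<le> (real L - 1) * ?T + (real m + 2 * real L) * ?c"
    using c0 by (simp add: algebra_simps)
  finally have "real m * ((\<Sum>r\<in>?I. \<Sum>j<card (hits r) + 1. gain l j) + real (card missed) * ?c)
      \<le> real m * ((real L - 1) * ?T + (real m + 2 * real L) * ?c)"
    by (intro mult_left_mono) auto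
  also have "\<dots> = real m * (real L - 1) * ?T + (real m + 2 * real L) * (real m * ?c)"
    by (simp add: algebra_simps)
  also have "\<dots> \<le> real m * (real L - 1) * ?T + (real m + 2 * real L) * ?T"
    using mc by (intro add_left_mono mult_left_mono) auto
  also have "\<dots> = real L * (real m + 2) * ?T"
    by (simp add: algebra_simps)
  finally show ?thesis .
qed

text \<open>\<open>view l r\<close> is bounded only together with \<open>view r l\<close>. Summing
  over ordered pairs counts everything twice on both sides, and exchanging the indices removes the
  factor 2.\<close>

lemma sum_view_le:
  "(\<Sum>l<L. \<Sum>r\<in>{..<L} - {l}. view l r) \<le> (\<Sum>l<L. \<Sum>r\<in>{..<L} - {l}. \<Sum>j<card (hits r) + 1. gain l j)"
proof -
  let ?S = "\<lambda>l r. \<Sum>j<card (hits r) + 1. gain l j"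
  have swap: "(\<Sum>l<L. \<Sum>r\<in>{..<L} - {l}. w r l) = (\<Sum>l<L. \<Sum>r\<in>{..<L} - {l}. w l r)"
    for w :: "nat \<Rightarrow> nat \<Rightarrow> real"
  proof -
    have *: "(\<Sum>l<L. \<Sum>r\<in>{..<L} - {l}. w l r) = (\<Sum>l<L. \<Sum>r<L. if l = r then 0 else w l r)"
      for w :: "nat \<Rightarrow> nat \<Rightarrow> real"
      by (intro sum.cong refl sum.mono_neutral_cong_left) auto
    show ?thesis
      unfolding * by (subst sum.swap) (intro sum.cong refl, auto)
  qed
  have "(\<Sum>l<L. \<Sum>r\<in>{..<L} - {l}. view l r + view r l) \<le> (\<Sum>l<L. \<Sum>r\<in>{..<L} - {l}. ?S l r + ?S r l)"
  proof (intro sum_mono)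
    fix l r assume "l \<in> {..<L}" "r \<in> {..<L} - {l}"
    then show "view l r + view r l \<le> ?S l r + ?S r l"
      using view_pair_le[of l r] view_pair_le[of r l] by (cases "l < r") (auto simp: add.commute)
  qed
  then show ?thesis
    using swap[of view] swap[of ?S] by (simp add: sum.distrib)
qed

lemma sum_Opt_gain_le:
  assumes "card Opt < L * (m + 1)"
  shows "real m * (\<Sum>l<L. F (Opt \<union> A l m) - F (A l m)) \<le>
    real L * (real m + 2) * (\<Sum>l<L. F (A l m) - F G)"
proof (cases "m = 0")
  case True
  then show ?thesis by (simp add: A_def)
next
  case False
  let ?w = "\<lambda>l. real (card missed) * gain l (m - 1)"
  have "(\<Sum>l<L. F (Opt \<union> A l m) - F (A l m)) \<le> (\<Sum>l<L. (\<Sum>r\<in>{..<L} - {l}. view l r) + ?w l)"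
    using False by (intro sum_mono Opt_gain_le) auto
  also have "\<dots> \<le> (\<Sum>l<L. (\<Sum>r\<in>{..<L} - {l}. \<Sum>j<card (hits r) + 1. gain l j) + ?w l)"
    using sum_view_le by (simp add: sum.distrib)
  finally have "real m * (\<Sum>l<L. F (Opt \<union> A l m) - F (A l m)) \<le>
      real m * (\<Sum>l<L. (\<Sum>r\<in>{..<L} - {l}. \<Sum>j<card (hits r) + 1. gain l j) + ?w l)"
    by (intro mult_left_mono) auto
  also have "\<dots> = (\<Sum>l<L. real m * ((\<Sum>r\<in>{..<L} - {l}. \<Sum>j<card (hits r) + 1. gain l j) + ?w l))"
    by (simp add: sum_distrib_left)
  also have "\<dots> \<le> (\<Sum>l<L. real L * (real m + 2) * (\<Sum>j<m. gain l j))"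
    using False assms by (intro sum_mono charged_gain_le) auto
  also have "\<dots> = real L * (real m + 2) * (\<Sum>l<L. F (A l m) - F G)"
    by (simp add: sum_gain sum_distrib_left)
  finally show ?thesis .
qed

lemma sum_Opt_Un_ge:
  assumes "\<forall>S\<subseteq>X. 0 \<le> F S"
  shows "(real L - 1) * F (Opt \<union> G) \<le> (\<Sum>l<L. F (Opt \<union> A l m))"
proof (rule submodular_on_sum_ge[OF submod assms])
  fix l r assume "l < L" "r < L" "l \<noteq> r"
  then show "(Opt \<union> A l m) \<inter> (Opt \<union> A r m) \<subseteq> Opt \<union> G"
    using A_Int_A[of l r m] by auto
next
  fix l assume "l < L"
  then show "Opt \<union> G \<subseteq> Opt \<union> A l m \<and> Opt \<union> A l m \<subseteq> X"
    using Opt_subset A_subset[of l m] by (auto simp: A_def)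
qed (use Opt_subset G_subset in auto)

end

end

section \<open>Running the program\<close>

text \<open>Bodies that run to point masses make the loop a point mass too. \<open>I\<close> depends
  on the number of completed passes, so the induction hands the remaining list the invariant shifted
  by one.\<close>

lemma run_for_each_deterministic:
  assumes "I 0 s"
    and "\<And>i s. i < length xs \<Longrightarrow> I i s \<Longrightarrow>
      \<exists>s' q. run f (body (xs ! i) s) = return_pmf (s', q) \<and> q \<le> Q \<and> I (Suc i) s'"
  shows "\<exists>s' q. run f (for_each xs body s) = return_pmf (s', q) \<and> q \<le> Q * length xs \<and> I (length xs) s'"
  using assms
proof (induction xs arbitrary: I s)
  case (Cons x xs)
  obtain s' q where 1: "run f (body x s) = return_pmf (s', q)" "q \<le> Q" "I (Suc 0) s'"
    using Cons.prems(2)[of 0 s] Cons.prems(1) by auto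
  have "\<exists>s'' q'. run f (for_each xs body s') = return_pmf (s'', q') \<and> q' \<le> Q * length xs
      \<and> I (Suc (length xs)) s''"
    by (rule Cons.IH[of "\<lambda>i. I (Suc i)", OF 1(3)]) (use Cons.prems(2) in fastforce)
  then obtain s'' q' where 2: "run f (for_each xs body s') = return_pmf (s'', q')"
      "q' \<le> Q * length xs" "I (Suc (length xs)) s''"
    by auto
  show ?case
    using 1 2 by (auto simp: run_bind_prog bind_return_pmf)
qed simp

text \<open>
  The elements chosen in one outer iteration form a single sequence \<open>b\<close>; the one chosen at time
  \<open>u\<close> goes to the set with index \<open>u mod L + 1\<close>.
\<close>

definition greedy_trace ::
  "'b set \<Rightarrow> ('b set \<Rightarrow> real) \<Rightarrow> 'b set \<Rightarrow> nat \<Rightarrow> nat \<Rightarrow> (nat \<Rightarrow> 'b) \<Rightarrow> bool" where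
  "greedy_trace X F G L t b \<longleftrightarrow> (\<forall>u<t. let C = G \<union> b ` {v. v < u \<and> v mod L = u mod L} in
     b u \<in> X - (G \<union> b ` {..<u}) \<and> F C \<le> F (insert (b u) C) \<and>
     (\<forall>x \<in> X - (G \<union> b ` {..<u}). F (insert x C) \<le> F (insert (b u) C)))"

text \<open>The sets do not record the order of choice, hence the existential \<open>b\<close>. The
  program numbers its sets from 1 while residues start at 0, hence \<open>Suc r\<close>.\<close>

definition loop_inv ::
  "'b set \<Rightarrow> ('b set \<Rightarrow> real) \<Rightarrow> 'b set \<Rightarrow> nat \<Rightarrow> nat \<Rightarrow> (nat \<Rightarrow> 'b set) \<Rightarrow> bool" where
  "loop_inv X F G L t A \<longleftrightarrow> (\<exists>b. greedy_trace X F G L t b \<and>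
     (\<forall>r<L. A (Suc r) = G \<union> b ` {u. u < t \<and> u mod L = r}))"

lemma residue_class_below:
  assumes "r < (L::nat)"
  shows "{v. v < j * L + r \<and> v mod L = r} = (\<lambda>i. i * L + r) ` {..<j}"
    and "{v. v < j * L \<and> v mod L = r} = (\<lambda>i. i * L + r) ` {..<j}"
proof -
  have *: "v < j * L \<longleftrightarrow> v div L < j" for v
    using assms by (subst div_less_iff_less_mult) auto
  have **: "v < j * L + r \<longleftrightarrow> v div L < j" if "v mod L = r" for v
  proof -
    have "v = v div L * L + r"
      using that by (metis div_mult_mod_eq)
    moreover have "v div L * L + r < j * L + r \<longleftrightarrow> v div L < j"
      using assms by simp
    ultimately show ?thesis by metis
  qed
  have img: "{v. v div L < j \<and> v mod L = r} = (\<lambda>i. i * L + r) ` {..<j}"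
  proof (intro equalityI subsetI)
    fix v assume "v \<in> {v. v div L < j \<and> v mod L = r}"
    then show "v \<in> (\<lambda>i. i * L + r) ` {..<j}"
      by (intro image_eqI[of _ _ "v div L"]) (auto simp: div_mult_mod_eq)
  qed (use assms in auto)
  show "{v. v < j * L + r \<and> v mod L = r} = (\<lambda>i. i * L + r) ` {..<j}"
    unfolding img[symmetric] using ** by auto
  show "{v. v < j * L \<and> v mod L = r} = (\<lambda>i. i * L + r) ` {..<j}"
    unfolding img[symmetric] using * by auto
qed

lemma lex_time_less:
  assumes "r < L" "r' < L" "j' < j \<or> j' = j \<and> r' < (r::nat)"
  shows "j' * L + r' < j * L + r"
proof (cases "j' = j")
  case False
  then have "Suc j' * L \<le> j * L"
    using assms(3) by (intro mult_le_mono1) auto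
  then show ?thesis
    using assms by simp
qed (use assms in auto)

text \<open>Time \<open>j * L + r\<close> is round \<open>j\<close> of sequence \<open>r\<close>,
  and the order of times is the lexicographic order of \<open>(j, r)\<close>, so the trace
  conditions translate pair by pair.\<close>

lemma interlaced_sequences_of_trace:
  assumes "finite X" "submodular_on X F" "G \<subseteq> X" and tr: "greedy_trace X F G L (m * L) b"
  shows "interlaced_sequences X F G (\<lambda>r j. b (j * L + r)) L m"
proof -
  have time: "j * L + r < m * L" if "r < L" "j < m" for r j
    using lex_time_less[of 0 L r j m] that by auto
  have modr: "(j * L + r) mod L = r" if "r < L" for r j
    using that by simp
  have cur: "b ` {v. v < j * L + r \<and> v mod L = (j * L + r) mod L} = (\<lambda>j. b (j * L + r)) ` {..<j}"
    if "r < L" for r j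
    using residue_class_below(1)[OF that, of j] modr[OF that] by (simp add: image_image)
  have ins: "insert (b (j * L + r)) (G \<union> (\<lambda>j. b (j * L + r)) ` {..<j}) = G \<union> (\<lambda>j. b (j * L + r)) ` {..<Suc j}"
    for r j
    by (auto simp: lessThan_Suc)
  have step: "b (j * L + r) \<in> X - (G \<union> b ` {..<j * L + r}) \<and>
      F (G \<union> (\<lambda>j. b (j * L + r)) ` {..<j}) \<le> F (G \<union> (\<lambda>j. b (j * L + r)) ` {..<Suc j}) \<and>
      (\<forall>x \<in> X - (G \<union> b ` {..<j * L + r}). F (insert x (G \<union> (\<lambda>j. b (j * L + r)) ` {..<j}))
        \<le> F (G \<union> (\<lambda>j. b (j * L + r)) ` {..<Suc j}))"
    if "r < L" "j < m" for r j
    using tr[unfolded greedy_trace_def, rule_format, OF time[OF that]]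
    unfolding Let_def cur[OF that(1)] ins .
  have distinct: "b u \<noteq> b v" if "u < v" "v < m * L" for u v
    using tr[unfolded greedy_trace_def, rule_format, OF that(2)] that(1) unfolding Let_def
    by (metis DiffD2 UnI2 imageI lessThan_iff)
  show ?thesis
  proof
    fix r j r' j' assume *: "r < L" "j < m" "r' < L" "j' < m" "b (j * L + r) = b (j' * L + r')"
    then have "j * L + r = j' * L + r'"
      using distinct time by (metis linorder_neq_iff)
    then have "r = r'"
      using modr * by metis
    with \<open>j * L + r = j' * L + r'\<close> * show "r = r' \<and> j = j'"
      by auto
  next
    fix r j x
    assume *: "r < L" "j < m" "x \<in> X - G"
      and x: "\<And>r' j'. r' < L \<Longrightarrow> j' < j \<or> j' = j \<and> r' < r \<Longrightarrow> x \<noteq> b (j' * L + r')"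
    \<comment> \<open>An earlier time \<open>u\<close> decodes to the earlier pair
      \<open>(u div L, u mod L)\<close>, so \<open>x\<close> avoids the whole trace so far.\<close>
    have "x \<noteq> b u" if "u < j * L + r" for u
    proof -
      have "u div L < j \<or> u div L = j \<and> u mod L < r"
      proof (rule ccontr)
        assume "\<not> ?thesis"
        then have "j \<le> u div L \<and> (u div L = j \<longrightarrow> r \<le> u mod L)"
          by auto
        then have "j * L + r \<le> u div L * L + u mod L"
          using lex_time_less[of "u mod L" L r j "u div L"] *(1)
          by (cases "u div L = j") (auto simp del: div_mult_mod_eq)
        then show False
          using that by simp
      qed
      then show ?thesis
        using x[of "u mod L" "u div L"] *(1) by auto
    qed
    then show "F (insert x (G \<union> (\<lambda>j. b (j * L + r)) ` {..<j})) \<le> F (G \<union> (\<lambda>j. b (j * L + r)) ` {..<Suc j})"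
      using step[OF *(1,2)] *(3) by blast
  qed (use assms step in blast)+
qed

section \<open>Dummy elements and the extended function\<close>

lemma genuine_Un: "genuine (S \<union> T) = genuine S \<union> genuine T"
  by (auto simp: genuine_def)

lemma genuine_Int: "genuine (S \<inter> T) = genuine S \<inter> genuine T"
  by (auto simp: genuine_def)

lemma genuine_subset: "S \<subseteq> set (ground us k) \<Longrightarrow> genuine S \<subseteq> set us"
  by (auto simp: genuine_def ground_def)

lemma submodular_on_ground:
  assumes "submodular_on (set us) f"
  shows "submodular_on (set (ground us k)) (\<lambda>S. f (genuine S))"
  using assms genuine_subset[of _ us k] by (simp add: submodular_on_def genuine_Un genuine_Int)

text \<open>The \<open>2 * k\<close> dummies cannot all lie in \<open>S\<close>. A free dummy has
  gain 0, so a greedy step always has a candidate and never has to accept a loss.\<close>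

lemma unused_dummy:
  assumes "finite S" "card S < 2 * k"
  obtains x where "x \<in> set (ground us k) - S" "\<And>C. genuine (insert x C) = genuine C"
proof -
  have "\<not> Inr ` {..<2 * k} \<subseteq> S"
  proof
    assume "Inr ` {..<2 * k} \<subseteq> S"
    then have "card (Inr ` {..<2 * k} :: ('a + nat) set) \<le> card S"
      using assms by (intro card_mono)
    then show False
      using assms by (simp add: card_image)
  qed
  then obtain i where "i < 2 * k" "Inr i \<notin> S"
    by auto
  then show ?thesis
    by (intro that[of "Inr i"]) (auto simp: ground_def genuine_def)
qed

lemma greedy_step_preserves:
  assumes inv: "loop_inv (set (ground us k)) (\<lambda>S. f (genuine S)) G L t A"
    and "L > 0" "finite G" "card G + t < 2 * k" "l = Suc (t mod L)"
    and pick: "\<And>M. M \<noteq> {} \<Longrightarrow> pick M \<in> M"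
  shows "\<exists>A' q. run f (greedy_step us k L pick l A) = return_pmf (A', q) \<and> q \<le> 2 * length us \<and>
    loop_inv (set (ground us k)) (\<lambda>S. f (genuine S)) G L (Suc t) A'"
proof -
  let ?X = "set (ground us k)" and ?F = "\<lambda>S. f (genuine S)"
  obtain b where b: "greedy_trace ?X ?F G L t b"
      and A: "\<And>r. r < L \<Longrightarrow> A (Suc r) = G \<union> b ` {u. u < t \<and> u mod L = r}"
    using inv unfolding loop_inv_def by auto
  have U: "(\<Union>r\<in>{1..L}. A r) = G \<union> b ` {..<t}"
  proof -
    have "(\<Union>r\<in>{1..L}. A r) = (\<Union>r<L. A (Suc r))"
      unfolding image_Suc_lessThan[symmetric] by (simp add: image_image)
    also have "\<dots> = G \<union> b ` {..<t}"
    proof (intro equalityI subsetI)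
      fix x assume "x \<in> G \<union> b ` {..<t}"
      then have "x \<in> G \<or> (\<exists>u<t. x = b u \<and> u mod L < L)"
        using \<open>L > 0\<close> by auto
      then show "x \<in> (\<Union>r<L. A (Suc r))"
        using A \<open>L > 0\<close> by blast
    qed (use A in blast)
    finally show ?thesis .
  qed
  define C where "C = A l"
  have C: "C = G \<union> b ` {v. v < t \<and> v mod L = t mod L}"
    unfolding C_def using A assms by simp
  define xs where "xs = filter (\<lambda>x. x \<notin> (\<Union>r\<in>{1..L}. A r)) (ground us k)"
  have xs: "set xs = ?X - (G \<union> b ` {..<t})"
    unfolding xs_def U by auto
  define M where "M = {x. is_arg_max (\<lambda>x. marginal f x C) (\<lambda>x. x \<in> set xs) x}"
  define a where "a = pick M"
  have "card (G \<union> b ` {..<t}) \<le> card G + t"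
    using card_Un_le[of G "b ` {..<t}"] card_image_le[of "{..<t}" b] by simp
  then obtain d where d: "d \<in> set xs" "\<And>C. genuine (insert d C) = genuine C"
    using unused_dummy[of "G \<union> b ` {..<t}" k us] assms(3,4) xs by auto
  have "M \<noteq> {}"
  proof -
    obtain x where x: "x \<in> set xs" "Max ((\<lambda>x. marginal f x C) ` set xs) = marginal f x C"
      by (rule obtains_MAX[of "set xs" "\<lambda>x. marginal f x C"]) (use d(1) in auto)
    have "marginal f y C \<le> marginal f x C" if "y \<in> set xs" for y
      using Max_ge[of "(\<lambda>x. marginal f x C) ` set xs" "marginal f y C"] that x(2) by simp
    then have "x \<in> M"
      using x(1) by (simp add: M_def is_arg_max_linorder)
    then show ?thesis by auto
  qed
  then have "a \<in> M"
    unfolding a_def by (rule pick)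
  then have a: "a \<in> set xs" "\<And>x. x \<in> set xs \<Longrightarrow> ?F (insert x C) \<le> ?F (insert a C)"
    by (auto simp: M_def is_arg_max_linorder marginal_def)
  have nonneg: "?F C \<le> ?F (insert a C)"
    using a(2)[OF d(1)] d(2) by simp
  let ?b = "b(t := a)"
  have upd: "?b ` S = b ` S" if "t \<notin> S" for S
    using that by (intro image_cong) auto
  have run: "run f (greedy_step us k L pick l A) =
      return_pmf (A(l := insert a C), 2 * length (filter isl xs))"
    unfolding greedy_step_def xs_def[symmetric] C_def[symmetric]
    by (simp add: run_bind_prog run_query_marginals bind_return_pmf Let_def maximizers_marginal
        a_def M_def)
  \<comment> \<open>Marginals of dummies cost no evaluation, so only the available original elements
    count, two evaluations each.\<close>
  have "filter isl xs = filter (\<lambda>x. x \<notin> (\<Union>r\<in>{1..L}. A r)) (filter isl (ground us k))"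
    unfolding xs_def by (simp add: conj_commute)
  then have "length (filter isl xs) \<le> length (filter isl (ground us k))"
    using length_filter_le[of "\<lambda>x. x \<notin> (\<Union>r\<in>{1..L}. A r)" "filter isl (ground us k)"] by simp
  also have "\<dots> = length us"
    by (simp add: ground_def filter_map comp_def)
  finally have q: "2 * length (filter isl xs) \<le> 2 * length us"
    by simp
  have "greedy_trace ?X ?F G L (Suc t) ?b"
    unfolding greedy_trace_def
  proof (intro allI impI)
    fix u assume "u < Suc t"
    then consider "u < t" | "u = t" by linarith
    then show "let C = G \<union> ?b ` {v. v < u \<and> v mod L = u mod L} in
        ?b u \<in> ?X - (G \<union> ?b ` {..<u}) \<and> ?F C \<le> ?F (insert (?b u) C) \<and>
        (\<forall>x \<in> ?X - (G \<union> ?b ` {..<u}). ?F (insert x C) \<le> ?F (insert (?b u) C))"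
    proof cases
      case 1
      then have "?b ` {v. v < u \<and> v mod L = u mod L} = b ` {v. v < u \<and> v mod L = u mod L}"
          "?b ` {..<u} = b ` {..<u}" "?b u = b u"
        by (auto intro!: upd)
      then show ?thesis
        using b 1 unfolding greedy_trace_def by simp
    next
      case 2
      have eq: "?b ` {v. v < u \<and> v mod L = u mod L} = b ` {v. v < t \<and> v mod L = t mod L}"
          "?b ` {..<u} = b ` {..<t}" "?b u = a"
        using 2 by (auto intro!: upd)
      show ?thesis
        unfolding Let_def eq C[symmetric] using a nonneg by (simp add: xs)
    qed
  qed
  moreover have "(A(l := insert a C)) (Suc r) = G \<union> ?b ` {u. u < Suc t \<and> u mod L = r}" if "r < L" for r
  proof (cases "r = t mod L")
    case True
    have "{u. u < Suc t \<and> u mod L = r} = insert t {u. u < t \<and> u mod L = r}"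
      using True by auto
    then have "?b ` {u. u < Suc t \<and> u mod L = r} = insert (?b t) (?b ` {u. u < t \<and> u mod L = r})"
      by (simp only: image_insert)
    also have "\<dots> = insert a (b ` {u. u < t \<and> u mod L = r})"
      by (subst upd) auto
    finally have image: "?b ` {u. u < Suc t \<and> u mod L = r} = insert a (b ` {u. u < t \<and> u mod L = r})" .
    show ?thesis
      unfolding image using True assms(5) C by simp
  next
    case False
    then have below: "{u. u < Suc t \<and> u mod L = r} = {u. u < t \<and> u mod L = r}"
      by (auto simp: less_Suc_eq)
    have image: "?b ` {u. u < t \<and> u mod L = r} = b ` {u. u < t \<and> u mod L = r}"
      by (rule upd) simp
    show ?thesis
      unfolding below image using False assms(5) A[OF that] by simp
  qed
  ultimately have "loop_inv ?X ?F G L (Suc t) (A(l := insert a C))"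
    unfolding loop_inv_def by blast
  with run q show ?thesis by blast
qed

lemma inner_loops_run:
  assumes "L > 0" "finite G" "card G \<le> k" "valid_tie_break tb"
  shows "\<exists>A q. run f (for_each [1..<Suc (k div L)]
      (\<lambda>j. for_each [1..<Suc L] (\<lambda>l. greedy_step us k L (tb h j l) l)) (\<lambda>_. G)) = return_pmf (A, q) \<and>
    q \<le> 2 * length us * L * (k div L) \<and>
    loop_inv (set (ground us k)) (\<lambda>S. f (genuine S)) G L (k div L * L) A"
proof -
  let ?inv = "loop_inv (set (ground us k)) (\<lambda>S. f (genuine S)) G L"
  have inner: "\<exists>A' q. run f (for_each [1..<Suc L] (\<lambda>l. greedy_step us k L (tb h j' l) l) A) = return_pmf (A', q) \<and>
      q \<le> 2 * length us * L \<and> ?inv (Suc j * L) A'"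
    if "j < k div L" "?inv (j * L) A" for j j' A
  proof -
    have "\<exists>A' q. run f (for_each [1..<Suc L] (\<lambda>l. greedy_step us k L (tb h j' l) l) A) = return_pmf (A', q) \<and>
        q \<le> 2 * length us * length [1..<Suc L] \<and> ?inv (j * L + length [1..<Suc L]) A'"
    proof (rule run_for_each_deterministic[where I = "\<lambda>i. ?inv (j * L + i)"])
      fix i A assume i: "i < length [1..<Suc L]" "?inv (j * L + i) A"
      then have "i < L" by (simp del: upt_Suc)
      \<comment> \<open>One outer iteration picks at most \<open>k\<close> elements and
        \<open>G\<close> has at most \<open>k\<close>, so before each pick a dummy is left; this is
        where the supply \<open>2 * k\<close> comes from.\<close>
      have "j * L + i < k div L * L"
        using lex_time_less[of 0 L i j "k div L"] that(1) \<open>i < L\<close> by simp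
      also have "\<dots> \<le> k"
        by simp
      finally have "card G + (j * L + i) < 2 * k"
        using assms(3) by simp
      moreover have "[1..<Suc L] ! i = Suc ((j * L + i) mod L)"
        using \<open>i < L\<close> by (simp add: nth_upt del: upt_Suc)
      ultimately show "\<exists>A' q. run f (greedy_step us k L (tb h j' ([1..<Suc L] ! i)) ([1..<Suc L] ! i) A) = return_pmf (A', q)
          \<and> q \<le> 2 * length us \<and> ?inv (j * L + Suc i) A'"
        using greedy_step_preserves[OF i(2) assms(1,2)] assms(4)
        unfolding valid_tie_break_def add_Suc_right by blast
    qed (use that in simp)
    then show ?thesis
      by (simp add: add.commute del: upt_Suc)
  qed
  have "\<exists>A q. run f (for_each [1..<Suc (k div L)]
      (\<lambda>j. for_each [1..<Suc L] (\<lambda>l. greedy_step us k L (tb h j l) l)) (\<lambda>_. G)) = return_pmf (A, q) \<and>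
      q \<le> 2 * length us * L * length [1..<Suc (k div L)] \<and> ?inv (length [1..<Suc (k div L)] * L) A"
  proof (rule run_for_each_deterministic[where I = "\<lambda>j. ?inv (j * L)"])
    show "?inv (0 * L) (\<lambda>_. G)"
      by (simp add: loop_inv_def greedy_trace_def)
  qed (use inner in \<open>auto simp del: upt_Suc\<close>)
  then show ?thesis
    by (simp del: upt_Suc)
qed

lemma outer_iteration_gains:
  fixes F :: "'b set \<Rightarrow> real"
  assumes "finite X" "submodular_on X F" "\<forall>S\<subseteq>X. 0 \<le> F S" "G \<subseteq> X" "Opt \<subseteq> X"
    and "card Opt < L * (m + 1)" "loop_inv X F G L (m * L) A"
  defines "\<beta> \<equiv> real m / (real L * (real m + 2))"
  shows "l \<in> {1..L} \<Longrightarrow> A l \<subseteq> X" "l \<in> {1..L} \<Longrightarrow> card (A l) \<le> card G + m"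
    and "(1 - 1 / real L) * (real L * F G + \<beta> * (\<Sum>l=1..L. F (Opt \<union> A l))) \<le> (\<Sum>l=1..L. F (A l))"
    and "(real L - 1) * F (Opt \<union> G) \<le> (\<Sum>l=1..L. F (Opt \<union> A l))"
proof -
  obtain b where b: "greedy_trace X F G L (m * L) b"
      and A: "\<And>r. r < L \<Longrightarrow> A (Suc r) = G \<union> b ` {u. u < m * L \<and> u mod L = r}"
    using assms(7) unfolding loop_inv_def by auto
  interpret S: interlaced_sequences X F G "\<lambda>r j. b (j * L + r)" L m
    using assms(1,2,4) b by (rule interlaced_sequences_of_trace)
  have A': "A (Suc r) = S.A r m" if "r < L" for r
    using A[OF that] residue_class_below(2)[OF that, of m] by (simp add: S.A_def image_image)
  have A'': "A l = S.A (l - 1) m" "l - 1 < L" if "l \<in> {1..L}" for l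
    using that A'[of "l - 1"] by auto
  have L: "L > 0"
    using assms(6) by (cases L) auto
  have sumA: "(\<Sum>l=1..L. w (A l)) = (\<Sum>l<L. w (S.A l m))" for w :: "'b set \<Rightarrow> real"
    by (simp add: sum.atLeast1_atMost_eq A')
  show "A l \<subseteq> X" if "l \<in> {1..L}"
    unfolding A''(1)[OF that] using A''(2)[OF that] by (rule S.A_subset) simp
  show "card (A l) \<le> card G + m" if "l \<in> {1..L}"
  proof -
    have "A l = G \<union> (\<lambda>j. b (j * L + (l - 1))) ` {..<m}"
      using A''[OF that] by (simp add: S.A_def)
    then show ?thesis
      using card_Un_le[of G "(\<lambda>j. b (j * L + (l - 1))) ` {..<m}"]
        card_image_le[of "{..<m}" "\<lambda>j. b (j * L + (l - 1))"] by simp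
  qed
  show "(real L - 1) * F (Opt \<union> G) \<le> (\<Sum>l=1..L. F (Opt \<union> A l))"
    using S.sum_Opt_Un_ge[OF assms(5,3)] sumA[of "\<lambda>S. F (Opt \<union> S)"] by simp
  let ?x = "\<Sum>l=1..L. F (A l)" and ?y = "\<Sum>l=1..L. F (Opt \<union> A l)"
  have "real m * (?y - ?x) \<le> real L * (real m + 2) * (?x - real L * F G)"
    using S.sum_Opt_gain_le[OF assms(5,6)] sumA[of F] sumA[of "\<lambda>S. F (Opt \<union> S)"]
    by (simp add: sum_subtractf)
  then have "\<beta> * (?y - ?x) \<le> ?x - real L * F G"
    unfolding \<beta>_def using L by (simp add: divide_le_eq mult.commute)
  then have "real L * F G + \<beta> * ?y \<le> (1 + \<beta>) * ?x"
    by (simp add: algebra_simps)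
  \<comment> \<open>Instead of dividing by \<open>1 + \<beta>\<close>, both sides are multiplied by
    \<open>1 - 1 / L\<close>: as \<open>\<beta>\<close> is at most \<open>1 / L\<close>, the product
    \<open>(1 - 1 / L) * (1 + \<beta>)\<close> is at most 1.\<close>
  then have "(1 - 1 / real L) * (real L * F G + \<beta> * ?y) \<le> (1 - 1 / real L) * ((1 + \<beta>) * ?x)"
    using L by (intro mult_left_mono) auto
  also have "\<dots> = ((1 - 1 / real L) * (1 + \<beta>)) * ?x"
    by simp
  also have "\<dots> \<le> 1 * ?x"
  proof (rule mult_right_mono)
    have "\<beta> \<le> 1 / real L"
      using divide_right_mono[of "real m / (real m + 2)" 1 "real L"] by (simp add: \<beta>_def mult.commute)
    then have "(1 - 1 / real L) * (1 + \<beta>) \<le> (1 - 1 / real L) * (1 + 1 / real L)"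
      using L by (intro mult_left_mono) auto
    also have "\<dots> \<le> 1"
      by (simp add: algebra_simps)
    finally show "(1 - 1 / real L) * (1 + \<beta>) \<le> 1" .
    show "0 \<le> ?x"
    proof (rule sum_nonneg)
      fix l assume "l \<in> {1..L}"
      then show "0 \<le> F (A l)"
        using A''[of l] S.A_subset[of "l - 1" m] by (intro assms(3)[rule_format]) auto
    qed
  qed
  finally show "(1 - 1 / real L) * (real L * F G + \<beta> * ?y) \<le> ?x"
    by simp
qed

section \<open>Expected value and query complexity\<close>

text \<open>Induction on the iterations still to run, for every starting set. As an iteration adds
  at most \<open>m\<close> elements, \<open>card G + length xs * m \<le> k\<close> keeps every inner
  loop within the supply of dummies. Finite support is carried along for splitting the expectation
  over the uniform draw.\<close>

lemma outer_loop_bounds: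
  fixes f :: "'a set \<Rightarrow> real" and k L :: nat
  assumes "L > 0" "valid_tie_break tb" "submodular_on (set us) f"
    and nonneg: "\<forall>S\<subseteq>set us. 0 \<le> f S"
    and Opt: "Opt \<subseteq> set (ground us k)" "card Opt \<le> k"
  defines "m \<equiv> k div L"
  defines "\<beta> \<equiv> real m / (real L * (real m + 2))" and "d \<equiv> 1 - 1 / real L"
  assumes "G \<subseteq> set (ground us k)" "card G + length xs * m \<le> k"
  shows "finite (set_pmf (run f (for_each xs (\<lambda>_. outer_iteration us k L tb) (h, G)))) \<and>
    (\<forall>(s, q) \<in> set_pmf (run f (for_each xs (\<lambda>_. outer_iteration us k L tb) (h, G))).
       q \<le> 2 * length us * L * m * length xs) \<and>
    d ^ length xs * f (genuine G)
        + real (length xs) * \<beta> * d ^ (length xs + 1) * f (genuine (Opt \<union> G))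
      \<le> measure_pmf.expectation (run f (for_each xs (\<lambda>_. outer_iteration us k L tb) (h, G)))
          (\<lambda>((h, G), q). f (genuine G))"
  using assms(10,11)
proof (induction xs arbitrary: h G)
  case Nil
  then show ?case by simp
next
  case (Cons x xs)
  let ?X = "set (ground us k)" and ?F = "\<lambda>S. f (genuine S)" and ?t = "length xs"
  let ?val = "\<lambda>((h, G), q). f (genuine G)" and ?Q = "2 * length us * L * m"
  have fin: "finite G"
    using Cons.prems(1) by (rule finite_subset) simp
  obtain A q0 where A: "run f (for_each [1..<Suc (k div L)]
        (\<lambda>j. for_each [1..<Suc L] (\<lambda>l. greedy_step us k L (tb h j l) l)) (\<lambda>_. G)) = return_pmf (A, q0)"
      "q0 \<le> ?Q" "loop_inv ?X ?F G L (m * L) A"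
    using inner_loops_run[OF assms(1) fin _ assms(2), of k f us h] Cons.prems(2) unfolding m_def by auto
  have "k < L * (m + 1)"
    unfolding m_def using assms(1) by (metis Suc_eq_plus1 dividend_less_times_div mult_Suc_right)
  then have card_Opt: "card Opt < L * (m + 1)"
    using Opt(2) by simp
  have F: "submodular_on ?X ?F" "\<forall>S\<subseteq>?X. 0 \<le> ?F S"
    using submodular_on_ground[OF assms(3)] nonneg genuine_subset[of _ us k] by auto
  note gains = outer_iteration_gains[OF finite_set F Cons.prems(1) Opt(1) card_Opt A(3),
      folded \<beta>_def d_def]
  define P where "P l = run f (for_each xs (\<lambda>_. outer_iteration us k L tb) (h @ [l], A l))" for l
  have IH: "finite (set_pmf (P l)) \<and> (\<forall>(s, q) \<in> set_pmf (P l). q \<le> ?Q * ?t) \<and>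
      d ^ ?t * ?F (A l) + real ?t * \<beta> * d ^ (?t + 1) * ?F (Opt \<union> A l) \<le> measure_pmf.expectation (P l) ?val"
    if "l \<in> {1..L}" for l
    unfolding P_def using gains(1,2)[OF that] Cons.prems(2) by (intro Cons.IH) auto
  let ?p = "run f (for_each (x # xs) (\<lambda>_. outer_iteration us k L tb) (h, G))"
  have run: "?p = pmf_of_set {1..L} \<bind> (\<lambda>l. map_pmf (\<lambda>(s, q). (s, q0 + q)) (P l))"
    unfolding P_def using A(1)
    by (simp add: outer_iteration_def run_bind_prog bind_return_pmf bind_assoc_pmf map_bind_pmf
        bind_map_pmf map_pmf_comp case_prod_unfold del: upt_Suc)
  have ne: "{1..L} \<noteq> {}"
    using assms(1) by auto
  have set: "set_pmf ?p = (\<Union>l\<in>{1..L}. (\<lambda>(s, q). (s, q0 + q)) ` set_pmf (P l))"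
    unfolding run using ne by simp
  have "finite (set_pmf ?p)"
    unfolding set using IH by auto
  moreover have "\<forall>(s, q) \<in> set_pmf ?p. q \<le> ?Q * length (x # xs)"
  proof -
    have "q0 + q \<le> ?Q * length (x # xs)" if "l \<in> {1..L}" "(s, q) \<in> set_pmf (P l)" for l s q
    proof -
      have "q \<le> ?Q * ?t"
        using IH[OF that(1)] that(2) by auto
      then show ?thesis
        using A(2) by simp
    qed
    then show ?thesis
      unfolding set by fast
  qed
  moreover have "d ^ Suc ?t * ?F G + real (Suc ?t) * \<beta> * d ^ (Suc ?t + 1) * ?F (Opt \<union> G)
      \<le> measure_pmf.expectation ?p ?val"
  proof -
    have d0: "0 \<le> d" and \<beta>0: "0 \<le> \<beta>"
      using assms(1) by (auto simp: d_def \<beta>_def)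
    let ?x = "\<Sum>l=1..L. ?F (A l)" and ?y = "\<Sum>l=1..L. ?F (Opt \<union> A l)"
    have Ld: "real L * d = real L - 1"
      using assms(1) by (simp add: d_def field_simps)
    have "real L * (d ^ Suc ?t * ?F G + real (Suc ?t) * \<beta> * d ^ (Suc ?t + 1) * ?F (Opt \<union> G))
        = d ^ ?t * (d * (real L * ?F G)) + real (Suc ?t) * \<beta> * d ^ Suc ?t * ((real L * d) * ?F (Opt \<union> G))"
      by (simp add: algebra_simps)
    also have "\<dots> \<le> d ^ ?t * (d * (real L * ?F G)) + real (Suc ?t) * \<beta> * d ^ Suc ?t * ?y"
      unfolding Ld using d0 \<beta>0 gains(4) by (intro add_left_mono mult_left_mono) auto
    \<comment> \<open>One of the \<open>Suc ?t\<close> copies of the \<open>Opt\<close> term joins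
      \<open>?F G\<close> and is turned into values \<open>?F (A l)\<close> by this iteration; the
      other \<open>?t\<close> copies are what the induction hypothesis expects.\<close>
    also have "\<dots> = d ^ ?t * (d * (real L * ?F G + \<beta> * ?y)) + real ?t * \<beta> * d ^ (?t + 1) * ?y"
      by (simp add: algebra_simps)
    also have "\<dots> \<le> d ^ ?t * ?x + real ?t * \<beta> * d ^ (?t + 1) * ?y"
      using d0 gains(3) by (intro add_right_mono mult_left_mono) auto
    also have "\<dots> = (\<Sum>l=1..L. d ^ ?t * ?F (A l) + real ?t * \<beta> * d ^ (?t + 1) * ?F (Opt \<union> A l))"
      by (simp add: sum.distrib sum_distrib_left)
    also have "\<dots> \<le> (\<Sum>l=1..L. measure_pmf.expectation (P l) ?val)"
      using IH by (intro sum_mono) auto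
    also have "\<dots> = real L * measure_pmf.expectation ?p ?val"
    proof -
      have "measure_pmf.expectation ?p ?val = (\<Sum>l=1..L. measure_pmf.expectation
          (map_pmf (\<lambda>(s, q). (s, q0 + q)) (P l)) ?val /\<^sub>R real (card {1..L}))"
        unfolding run using ne IH by (intro pmf_expectation_bind_pmf_of_set) auto
      also have "\<dots> = (\<Sum>l=1..L. measure_pmf.expectation (P l) ?val) / real L"
        by (simp add: case_prod_unfold sum_distrib_left divide_inverse mult.commute)
      finally show ?thesis
        using assms(1) by simp
    qed
    finally show ?thesis
      using assms(1) by simp
  qed
  ultimately show ?case
    by simp
qed

section \<open>Numerical estimates\<close>

lemma exp_neg_1_le_power:
  assumes "L \<ge> 2"
  shows "1 / exp 1 \<le> (1 - 1 / real L) ^ (L - 1)"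
proof -
  have pos: "0 < 1 - 1 / real L"
    using assms by simp
  \<comment> \<open>The inequality \<open>1 + x \<le> exp x\<close> at
    \<open>x = 1 / (L - 1)\<close>, raised to the power \<open>L - 1\<close>, bounds the reciprocal
    of the right side by \<open>exp 1\<close>.\<close>
  have "1 / (1 - 1 / real L) = 1 + 1 / real (L - 1)"
    using assms by (simp add: field_simps of_nat_diff)
  also have "\<dots> \<le> exp (1 / real (L - 1))"
    by (rule exp_ge_add_one_self)
  finally have "(1 / (1 - 1 / real L)) ^ (L - 1) \<le> exp (1 / real (L - 1)) ^ (L - 1)"
    using pos by (intro power_mono) auto
  also have "\<dots> = exp 1"
    using assms by (simp flip: exp_of_nat_mult)
  finally show ?thesis
    using pos by (simp add: power_divide field_simps)
qed

text \<open>In the main case \<open>(1 - 1 / L) ^ (L + 1)\<close> is at least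
  \<open>(1 / e) * (1 - 2 / L)\<close>, and \<open>m / (m + 2)\<close> is
  \<open>1 - 2 / (m + 2)\<close>. The hypothesis on \<open>k\<close> makes the product of
  \<open>1 - 2 / L\<close> and \<open>1 - 2 / (m + 2)\<close> at least
  \<open>1 - e * \<epsilon>\<close>.\<close>

lemma approximation_ratio:
  fixes \<epsilon> :: real and k L :: nat
  assumes "L > 0" "k > 0" "real L \<ge> 2 / (exp 1 * \<epsilon>)" "\<epsilon> > 0" "exp 1 * \<epsilon> - 2 / real L \<noteq> 0"
    and k: "real k \<ge> 2 * (exp 1 * real L - 2) / (exp 1 * \<epsilon> - 2 / real L)"
  defines "m \<equiv> k div L"
  shows "1 / exp 1 - \<epsilon> \<le> real L * (real m / (real L * (real m + 2))) * (1 - 1 / real L) ^ (L + 1)"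
proof (cases "L \<ge> 3")
  case False
  \<comment> \<open>For \<open>L\<close> at most 2 the lower bound on \<open>L\<close> forces
    \<open>exp 1 * \<epsilon>\<close> to be at least 1, so the left side is not positive.\<close>
  have "2 / real L \<le> exp 1 * \<epsilon>"
    using assms(1,3,4) by (simp add: field_simps)
  moreover have "1 \<le> 2 / real L"
    using False assms(1) by simp
  ultimately have "1 \<le> exp 1 * \<epsilon>"
    by linarith
  then have "1 / exp 1 - \<epsilon> \<le> 0"
    by (simp add: field_simps)
  also have "0 \<le> real L * (real m / (real L * (real m + 2))) * (1 - 1 / real L) ^ (L + 1)"
    using assms(1) by simp
  finally show ?thesis .
next
  case True
  define e :: real where "e = exp 1"
  have e: "e \<ge> 2"
    unfolding e_def using exp_ge_add_one_self[of 1] by simp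
  have "2 / real L \<le> e * \<epsilon>"
    unfolding e_def using assms(1,3,4) by (simp add: field_simps)
  then have "e * \<epsilon> - 2 / real L > 0"
    using assms(5) unfolding e_def by linarith
  then have "2 * (e * real L - 2) \<le> real k * (e * \<epsilon> - 2 / real L)"
    using k unfolding e_def by (simp add: divide_le_eq)
  then have eps: "2 * (e * real L - 2) / real k \<le> e * \<epsilon> - 2 / real L"
    using assms(2) by (simp add: divide_le_eq mult.commute)
  have "k < L * (m + 1)"
    unfolding m_def using assms(1) by (metis Suc_eq_plus1 dividend_less_times_div mult_Suc_right)
  then have "real k \<le> real (L * (m + 1))"
    by (intro of_nat_mono) simp
  then have km: "real k \<le> real L * (real m + 1)"
    by (simp add: algebra_simps)
  have eL: "2 * real L \<le> e * real L"
    using e by (intro mult_right_mono) auto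
  then have e4: "2 \<le> e * real L"
    using True by linarith
  have "(1 - 2 / real L) * (2 / (real m + 2)) = 2 * (real L - 2) / (real L * (real m + 2))"
    using assms(1) by (simp add: field_simps)
  also have "\<dots> \<le> 2 * (e * real L - 2) / (real L * (real m + 1))"
    using eL e4 True by (intro frac_le mult_left_mono) auto
  also have "\<dots> \<le> 2 * (e * real L - 2) / real k"
    using km e4 True assms(2) by (intro divide_left_mono) auto
  finally have "(1 - 2 / real L) * (2 / (real m + 2)) \<le> e * \<epsilon> - 2 / real L"
    using eps by linarith
  then have "1 - e * \<epsilon> \<le> (1 - 2 / real L) * (1 - 2 / (real m + 2))"
    by (simp add: algebra_simps)
  then have "(1 - e * \<epsilon>) / e \<le> (1 - 2 / real L) * (1 - 2 / (real m + 2)) / e"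
    using e by (intro divide_right_mono) auto
  then have "1 / e - \<epsilon> \<le> (1 - 2 / (real m + 2)) * ((1 / e) * (1 - 2 / real L))"
    using e by (simp add: field_simps)
  also have "\<dots> \<le> (1 - 2 / (real m + 2)) * ((1 - 1 / real L) ^ (L - 1) * (1 - 1 / real L)\<^sup>2)"
  proof (intro mult_left_mono mult_mono)
    show "1 / e \<le> (1 - 1 / real L) ^ (L - 1)"
      unfolding e_def using True by (intro exp_neg_1_le_power) auto
    show "1 - 2 / real L \<le> (1 - 1 / real L)\<^sup>2"
      by (simp add: power2_eq_square algebra_simps)
  qed (use True in \<open>auto simp: field_simps\<close>)
  also have "(1 - 1 / real L) ^ (L - 1) * (1 - 1 / real L)\<^sup>2 = (1 - 1 / real L) ^ (L + 1)"
    using assms(1) by (simp flip: power_add)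
  also have "1 - 2 / (real m + 2) = real m / (real m + 2)"
    by (simp add: field_simps)
  also have "\<dots> = real L * (real m / (real L * (real m + 2)))"
    using assms(1) by simp
  finally show ?thesis
    unfolding e_def .
qed

text \<open>The recursion starts from the empty set with all \<open>L\<close> iterations to go; the
  term with \<open>f {}\<close> is nonnegative and is dropped. The query count uses
  \<open>L * (k div L) \<le> k\<close>.\<close>

lemma interlaced_greedy_bounds:
  fixes f :: "'a set \<Rightarrow> real" and k L :: nat
  assumes "L > 0" "valid_tie_break tb" "submodular_on (set us) f"
    and nonneg: "\<forall>S\<subseteq>set us. 0 \<le> f S"
    and Opt: "Opt \<subseteq> set us" "card Opt \<le> k"
  shows "(G, q) \<in> set_pmf (run f (interlaced_greedy us k L tb)) \<Longrightarrow> q \<le> 2 * length us * k * L"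
    and "real L * (real (k div L) / (real L * (real (k div L) + 2))) * (1 - 1 / real L) ^ (L + 1) * f Opt
      \<le> measure_pmf.expectation (run f (interlaced_greedy us k L tb)) (\<lambda>(G, q). f (genuine G))"
proof -
  let ?m = "k div L"
  let ?p = "run f (for_each [1..<Suc L] (\<lambda>_. outer_iteration us k L tb) ([], {}))"
  have run: "run f (interlaced_greedy us k L tb) = map_pmf (\<lambda>((h, G), q). (G, q)) ?p"
    by (simp add: interlaced_greedy_def run_bind_prog map_pmf_def case_prod_unfold bind_return_pmf
        del: upt_Suc)
  have genuine_Opt: "genuine (Inl ` Opt) = Opt"
    by (auto simp: genuine_def)
  have "Inl ` Opt \<subseteq> set (ground us k)" "card (Inl ` Opt :: ('a + nat) set) \<le> k"
    using Opt by (auto simp: ground_def card_image)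
  from outer_loop_bounds[OF assms(1-3) nonneg this, of "{}" "[1..<Suc L]" "[]"]
  have bounds: "\<forall>(s, q) \<in> set_pmf ?p. q \<le> 2 * length us * L * ?m * L"
    "(1 - 1 / real L) ^ L * f {} + real L * (real ?m / (real L * (real ?m + 2))) * (1 - 1 / real L) ^ (L + 1) * f Opt
      \<le> measure_pmf.expectation ?p (\<lambda>((h, G), q). f (genuine G))"
    by (simp_all add: genuine_Opt genuine_def[of "{}"] del: upt_Suc)
  show "q \<le> 2 * length us * k * L" if "(G, q) \<in> set_pmf (run f (interlaced_greedy us k L tb))"
  proof -
    have "q \<le> 2 * length us * L * ?m * L"
      using that bounds(1) unfolding run by auto
    also have "\<dots> = 2 * length us * (L * ?m) * L"
      by simp
    also have "\<dots> \<le> 2 * length us * k * L"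
      by (intro mult_le_mono) auto
    finally show ?thesis .
  qed
  have "0 \<le> (1 - 1 / real L) ^ L * f {}"
    using assms(1) nonneg by simp
  then show "real L * (real ?m / (real L * (real ?m + 2))) * (1 - 1 / real L) ^ (L + 1) * f Opt
      \<le> measure_pmf.expectation (run f (interlaced_greedy us k L tb)) (\<lambda>(G, q). f (genuine G))"
    using bounds(2) unfolding run by (simp add: case_prod_unfold del: upt_Suc)
qed

text \<open>\<open>C\<close> is the constant implied by the bound of order
  \<open>1 / \<epsilon>\<close> on \<open>L\<close>; it is fixed before \<open>K\<close>, so
  \<open>K\<close> is uniform in all other data. The nonzero denominator excludes the case where
  division by 0 gives 0 and the condition on \<open>k\<close> says nothing.\<close>

theorem theorem3p3:
  fixes C :: real
  shows "\<exists>K. \<forall>(U :: 'a set) (us :: 'a list) (n :: nat) (f :: 'a set \<Rightarrow> real) (k :: nat)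
           (\<epsilon> :: real) (L :: nat) (Opt :: 'a set) (tb :: 'a tie_break).
      finite U \<longrightarrow> card U = n \<longrightarrow> distinct us \<longrightarrow> set us = U \<longrightarrow>
      submodular_on U f \<longrightarrow> (\<forall>S. S \<subseteq> U \<longrightarrow> f S \<ge> 0) \<longrightarrow>
      k > 0 \<longrightarrow> \<epsilon> > 0 \<longrightarrow>
      is_arg_max f (\<lambda>S. S \<subseteq> U \<and> card S \<le> k) Opt \<longrightarrow>
      L > 0 \<longrightarrow> real L \<le> C * (1 / \<epsilon>) \<longrightarrow> real L \<ge> 2 / (exp 1 * \<epsilon>) \<longrightarrow>
      exp 1 * \<epsilon> - 2 / real L \<noteq> 0 \<longrightarrow>
      real k \<ge> 2 * (exp 1 * real L - 2) / (exp 1 * \<epsilon> - 2 / real L) \<longrightarrow>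
      valid_tie_break tb \<longrightarrow>
      (\<forall>(G, q) \<in> set_pmf (run f (interlaced_greedy us k L tb)).
          real q \<le> K * (real k * real n / \<epsilon>)) \<and>
      measure_pmf.expectation (run f (interlaced_greedy us k L tb)) (\<lambda>(G, q). f (genuine G))
        \<ge> (1 / exp 1 - \<epsilon>) * f Opt"
proof (rule exI[of _ "2 * C"], intro allI impI conjI)
  fix U :: "'a set" and us :: "'a list" and n :: nat and f :: "'a set \<Rightarrow> real" and k :: nat
    and \<epsilon> :: real and L :: nat and Opt :: "'a set" and tb :: "'a tie_break"
  assume U: "finite U" "card U = n" "distinct us" "set us = U"
    and f: "submodular_on U f" "\<forall>S. S \<subseteq> U \<longrightarrow> f S \<ge> 0"
    and k: "k > 0" and \<epsilon>: "\<epsilon> > 0" and Opt: "is_arg_max f (\<lambda>S. S \<subseteq> U \<and> card S \<le> k) Opt"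
    and L: "L > 0" "real L \<le> C * (1 / \<epsilon>)" "real L \<ge> 2 / (exp 1 * \<epsilon>)" "exp 1 * \<epsilon> - 2 / real L \<noteq> 0"
    and kL: "real k \<ge> 2 * (exp 1 * real L - 2) / (exp 1 * \<epsilon> - 2 / real L)"
    and tb: "valid_tie_break tb"
  have Opt': "Opt \<subseteq> set us" "card Opt \<le> k"
    using Opt U by (auto simp: is_arg_max_def)
  have n: "length us = n"
    using U distinct_card[OF U(3)] by simp
  note bounds = interlaced_greedy_bounds[OF L(1) tb _ _ Opt', of f, unfolded U(4), OF f]
  show "\<forall>(G, q) \<in> set_pmf (run f (interlaced_greedy us k L tb)). real q \<le> 2 * C * (real k * real n / \<epsilon>)"
  proof safe
    fix G q assume "(G, q) \<in> set_pmf (run f (interlaced_greedy us k L tb))"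
    then have "q \<le> 2 * n * k * L"
      using bounds(1) n by blast
    then have "real q \<le> real (2 * n * k * L)"
      by (rule of_nat_mono)
    also have "\<dots> = 2 * real n * real k * real L"
      by simp
    \<comment> \<open>Replacing \<open>L\<close> by its upper bound \<open>C / \<epsilon>\<close>
      gives the witness \<open>2 * C\<close>.\<close>
    also have "\<dots> \<le> 2 * real n * real k * (C * (1 / \<epsilon>))"
      using L(2) by (intro mult_left_mono) auto
    also have "\<dots> = 2 * C * (real k * real n / \<epsilon>)"
      by simp
    finally show "real q \<le> 2 * C * (real k * real n / \<epsilon>)" .
  qed
  have "(1 / exp 1 - \<epsilon>) * f Opt
      \<le> real L * (real (k div L) / (real L * (real (k div L) + 2))) * (1 - 1 / real L) ^ (L + 1) * f Opt"
    using approximation_ratio[OF L(1) k L(3) \<epsilon> L(4) kL] f(2) Opt'(1) U(4)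
    by (intro mult_right_mono) auto
  also have "\<dots> \<le> measure_pmf.expectation (run f (interlaced_greedy us k L tb)) (\<lambda>(G, q). f (genuine G))"
    by (rule bounds(2))
  finally show "measure_pmf.expectation (run f (interlaced_greedy us k L tb)) (\<lambda>(G, q). f (genuine G))
      \<ge> (1 / exp 1 - \<epsilon>) * f Opt" .
qed

end
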